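(* Let $\psi$ be the unique element of $\mathrm{Hom}^+(\mathcal A[T_{\mathrm{LinOrder}}],\mathbb R)$ (the linear order). Then $\psi$ satisfies $\mathrm{UInduce}[\ell]$ for every $\ell\in\mathbb N$, but $\psi$ does not satisfy $\mathrm{UCouple}[1]$.
   Context: All languages are finite relational; predicates $P$ have arity $k(P)\ge1$. A canonical theory over $\mathcal L$ is a universal theory containing, for each $P\in\mathcal L$, the axiom that $P(x_1,\dots,x_{k(P)})$ fails whenever two $x_i$ coincide. $T_{\mathrm{LinOrder}}$ is the theory of strict linear orders (binary predicate $\prec$, irreflexive, total on distinct elements, transitive). $T\cup T'$ is the disjoint union; $\mathcal M[T]$: isomorphism classes of finite models. $\mathrm{Hom}^+(\mathcal A[T],\mathbb R)$: functions $\phi:\mathcal M[T]\to[0,1]$, $\phi(M)=\lim_n p(M,N_n)$ for finite models $N_n$ of strictly increasing size ($p(M,N)$ = probability a random $|M|$-subset of $V(N)$ induces a copy of $M$). $\phi(\langle K\rangle)=\frac{|\mathrm{Aut}(K)|}{|K|!}\phi([K])$. Theons: for an atomless complete probability space $\Omega=(X,\mathcal A,\mu)$, $\mathcal E_V(\Omega)=X^{r(V)}$, $r(V)$ the finite nonempty subsets of $V$, $\mathcal E_{V,r}(\Omega)=X^{\{A\in r(V):|A|\le r\}}$, $\alpha^*(x)_A=x_{\alpha(A)}$. A $T$-on is a family of measurable $\mathcal N_P\subseteq\mathcal E_{[k(P)]}(\Omega)$ such that for random $\theta\in\mathcal E_{\mathbb N_+}(\Omega)$ the structure on $\mathbb N_+$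 with $R_P=\{\alpha\text{ injective}:\alpha^*(\theta)\in\mathcal N_P\}$ is a.s. a model of $T$; $\phi_{\mathcal N}(M)$ is the probability that its restriction to $[|M|]$ is isomorphic to $M$; every $\phi$ is of this form. A peon $\mathcal N_P\subseteq\mathcal E_{[k]}(\Omega)$ has rank $\le r$ if $\mathcal N_P=\mathcal H\times X^{\{A\subseteq[k]:|A|>r\}}$; $\mathrm{rk}(\phi)$ is the minimal max-peon-rank of a representing $T$-on. Coupling of $\phi$ (theory $T$) and $\psi$ (theory $T'$): $\xi$ on $T\cup T'$ whose reducts are $\phi,\psi$; independent coupling $(\phi\otimes\psi)(\langle M\rangle)=\phi(\langle M|_T\rangle)\psi(\langle M|_{T'}\rangle)$; uniquely coupleable if it is the only coupling. $\mathrm{UCouple}[\ell]$: uniquely coupleable with every limit object of rank $\le\ell$ of every canonical theory. $T_{\ell\text{-Hypergraph}}$: single symmetric $\ell$-ary predicate. For $\ell\ge1$, $\phi$ satisfies $\mathrm{UInduce}[\ell]$ if for every $\psi'$ of $T_{\ell\text{-Hypergraph}}$, every coupling $\xi$ of $\phi$ and $\psi'$ and every $M\in\mathcal M[T\cup T_{\ell\text{-Hypergraph}}]$ whose hypergraph reduct is complete, $\xi(M)=(\phi\otimes\psi')(M)$; every $\phi$ satisfies $\mathrm{UInduce}[0]$. *)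

theory Defs
  imports "HOL-Probability.Probability"
begin

section \<open>Universal theories in finite relational languages\<close>

text \<open>
  Quantifier-free formulas; variables are natural numbers.  There is deliberately no constant
  for falsity, so that every formula has a variable and its universal closure holds in the
  empty structure.
\<close>

datatype 'p qf_form =
    Eq nat nat
  | Atom 'p "nat list"
  | Neg "'p qf_form"
  | Conj "'p qf_form" "'p qf_form"
  | Disj "'p qf_form" "'p qf_form"
  | Imp "'p qf_form" "'p qf_form"

text \<open>
  A universal theory together with its language: the predicate symbols, their arities, and the
  axioms, each of which stands for its universal closure.
\<close>

record 'p univ_theory =
  syms :: "'p set"
  ar :: "'p \<Rightarrow> nat"
  axs :: "'p qf_form set"

record 'p rel_struct =
  verts :: "nat set"
  rels :: "'p \<Rightarrow> nat list set"

primrec wf_form :: "'p univ_theory \<Rightarrow> 'p qf_form \<Rightarrow> bool" where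
  "wf_form T (Eq i j) \<longleftrightarrow> True"
| "wf_form T (Atom P xs) \<longleftrightarrow> P \<in> syms T \<and> length xs = ar T P"
| "wf_form T (Neg F) \<longleftrightarrow> wf_form T F"
| "wf_form T (Conj F G) \<longleftrightarrow> wf_form T F \<and> wf_form T G"
| "wf_form T (Disj F G) \<longleftrightarrow> wf_form T F \<and> wf_form T G"
| "wf_form T (Imp F G) \<longleftrightarrow> wf_form T F \<and> wf_form T G"

primrec holds :: "'p rel_struct \<Rightarrow> (nat \<Rightarrow> nat) \<Rightarrow> 'p qf_form \<Rightarrow> bool" where
  "holds M v (Eq i j) \<longleftrightarrow> v i = v j"
| "holds M v (Atom P xs) \<longleftrightarrow> map v xs \<in> rels M P"
| "holds M v (Neg F) \<longleftrightarrow> \<not> holds M v F"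
| "holds M v (Conj F G) \<longleftrightarrow> holds M v F \<and> holds M v G"
| "holds M v (Disj F G) \<longleftrightarrow> holds M v F \<or> holds M v G"
| "holds M v (Imp F G) \<longleftrightarrow> (holds M v F \<longrightarrow> holds M v G)"

text \<open>Symbols outside the language are interpreted as empty, so that they carry no information.\<close>

definition models :: "'p univ_theory \<Rightarrow> 'p rel_struct set" where
  "models T = {M.
     (\<forall>P\<in>syms T. rels M P \<subseteq> {xs. set xs \<subseteq> verts M \<and> length xs = ar T P}) \<and>
     (\<forall>P. P \<notin> syms T \<longrightarrow> rels M P = {}) \<and>
     (\<forall>F\<in>axs T. \<forall>v. range v \<subseteq> verts M \<longrightarrow> holds M v F)}"

definition finite_models :: "'p univ_theory \<Rightarrow> 'p rel_struct set" where
  "finite_models T = {M \<in> models T. finite (verts M)}"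

text \<open>The axioms saying that \<open>P(x\<^sub>0, \<dots>, x\<^sub>k\<^sub>-\<^sub>1)\<close> fails whenever two of the \<open>x\<^sub>i\<close> coincide.\<close>

definition canonical_axs :: "nat \<Rightarrow> 'p \<Rightarrow> 'p qf_form set" where
  "canonical_axs k P = {Imp (Eq i j) (Neg (Atom P [0..<k])) | i j. i < j \<and> j < k}"

definition canonical_theory :: "'p univ_theory \<Rightarrow> bool" where
  "canonical_theory T \<longleftrightarrow>
     finite (syms T) \<and> (\<forall>P\<in>syms T. 1 \<le> ar T P) \<and> (\<forall>F\<in>axs T. wf_form T F) \<and>
     (\<forall>P\<in>syms T. canonical_axs (ar T P) P \<subseteq> axs T)"

definition disj_union :: "'p univ_theory \<Rightarrow> 'q univ_theory \<Rightarrow> ('p + 'q) univ_theory"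
    (infixr "\<uplus>\<^sub>T" 65) where
  "T \<uplus>\<^sub>T T' = \<lparr>syms = syms T <+> syms T', ar = case_sum (ar T) (ar T'),
     axs = map_qf_form Inl ` axs T \<union> map_qf_form Inr ` axs T'\<rparr>"

definition left_reduct :: "('p + 'q) rel_struct \<Rightarrow> 'p rel_struct" where
  "left_reduct M = \<lparr>verts = verts M, rels = (\<lambda>P. rels M (Inl P))\<rparr>"

definition right_reduct :: "('p + 'q) rel_struct \<Rightarrow> 'q rel_struct" where
  "right_reduct M = \<lparr>verts = verts M, rels = (\<lambda>P. rels M (Inr P))\<rparr>"

subsection \<open>Linear orders and hypergraphs\<close>

definition lin_order_theory :: "unit univ_theory" where
  "lin_order_theory = \<lparr>syms = {()}, ar = (\<lambda>_. 2),
     axs = canonical_axs 2 () \<union>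
       {Neg (Atom () [0, 0]),
        Imp (Neg (Eq 0 1)) (Disj (Atom () [0, 1]) (Atom () [1, 0])),
        Imp (Conj (Atom () [0, 1]) (Atom () [1, 2])) (Atom () [0, 2])}\<rparr>"

definition hypergraph_theory :: "nat \<Rightarrow> unit univ_theory" where
  "hypergraph_theory l = \<lparr>syms = {()}, ar = (\<lambda>_. l),
     axs = canonical_axs l () \<union>
       {Imp (Atom () [0..<l]) (Atom () ys) | ys. mset ys = mset [0..<l]}\<rparr>"

definition complete_hypergraph :: "nat \<Rightarrow> unit rel_struct \<Rightarrow> bool" where
  "complete_hypergraph l M \<longleftrightarrow>
     (\<forall>xs. set xs \<subseteq> verts M \<and> length xs = l \<and> distinct xs \<longrightarrow> xs \<in> rels M ())"

lemma canonical_lin_order_theory: "canonical_theory lin_order_theory"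
  by (auto simp: canonical_theory_def lin_order_theory_def canonical_axs_def)

lemma canonical_hypergraph_theory: "1 \<le> l \<Longrightarrow> canonical_theory (hypergraph_theory l)"
proof -
  have "length ys = l" if "mset ys = mset [0..<l]" for ys :: "nat list"
    using mset_eq_length[OF that] by simp
  moreover assume "1 \<le> l"
  ultimately show ?thesis
    by (auto simp: canonical_theory_def hypergraph_theory_def canonical_axs_def simp del: mset_upt)
qed

section \<open>Isomorphism classes and limit objects\<close>

definition is_iso :: "(nat \<Rightarrow> nat) \<Rightarrow> 'p rel_struct \<Rightarrow> 'p rel_struct \<Rightarrow> bool" where
  "is_iso f M N \<longleftrightarrow> bij_betw f (verts M) (verts N) \<and>
     (\<forall>P xs. set xs \<subseteq> verts M \<longrightarrow> (xs \<in> rels M P \<longleftrightarrow> map f xs \<in> rels N P))"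

definition isomorphic :: "'p rel_struct \<Rightarrow> 'p rel_struct \<Rightarrow> bool" where
  "isomorphic M N \<longleftrightarrow> (\<exists>f. is_iso f M N)"

text \<open>Automorphisms are extended by the identity outside the vertex set, so that the set is finite.\<close>

definition Aut :: "'p rel_struct \<Rightarrow> (nat \<Rightarrow> nat) set" where
  "Aut M = {f. f permutes verts M \<and> is_iso f M M}"

definition iso_rel :: "'p univ_theory \<Rightarrow> ('p rel_struct \<times> 'p rel_struct) set" where
  "iso_rel T = {(M, N). M \<in> finite_models T \<and> N \<in> finite_models T \<and> isomorphic M N}"

definition iso_class :: "'p univ_theory \<Rightarrow> 'p rel_struct \<Rightarrow> 'p rel_struct set" where
  "iso_class T M = iso_rel T `` {M}"

text \<open>The set $\mathcal{M}[T]$; every finite model has a copy with vertices in \<open>nat\<close>.\<close>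

definition iso_classes :: "'p univ_theory \<Rightarrow> 'p rel_struct set set" where
  "iso_classes T = finite_models T // iso_rel T"

definition induced :: "'p rel_struct \<Rightarrow> nat set \<Rightarrow> 'p rel_struct" where
  "induced M U = \<lparr>verts = U, rels = (\<lambda>P. {xs \<in> rels M P. set xs \<subseteq> U})\<rparr>"

definition density :: "'p rel_struct \<Rightarrow> 'p rel_struct \<Rightarrow> real" where
  "density M N =
     real (card {U. U \<subseteq> verts N \<and> card U = card (verts M) \<and> isomorphic M (induced N U)}) /
     real (card (verts N) choose card (verts M))"

text \<open>$\mathrm{Hom}^+(\mathcal{A}[T],\mathbb{R})$\<close>

definition limit_objects :: "'p univ_theory \<Rightarrow> ('p rel_struct set \<Rightarrow> real) set" where
  "limit_objects T = {\<phi> \<in> iso_classes T \<rightarrow>\<^sub>E {0..1}.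
     \<exists>N :: nat \<Rightarrow> 'p rel_struct.
       (\<forall>n. N n \<in> finite_models T) \<and> strict_mono (\<lambda>n. card (verts (N n))) \<and>
       (\<forall>M\<in>finite_models T. (\<lambda>n. density M (N n)) \<longlonglongrightarrow> \<phi> (iso_class T M))}"

text \<open>$\phi(\langle K\rangle)$, the density of the labelled structure \<open>K\<close>.\<close>

definition labelled :: "'p univ_theory \<Rightarrow> ('p rel_struct set \<Rightarrow> real) \<Rightarrow> 'p rel_struct \<Rightarrow> real" where
  "labelled T \<phi> K = real (card (Aut K)) / fact (card (verts K)) * \<phi> (iso_class T K)"

section \<open>Couplings\<close>

definition left_marginal :: "'p univ_theory \<Rightarrow> 'q univ_theory \<Rightarrow>
    (('p + 'q) rel_struct set \<Rightarrow> real) \<Rightarrow> 'p rel_struct set \<Rightarrow> real" where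
  "left_marginal T T' \<xi> =
     (\<lambda>C\<in>iso_classes T. \<Sum>D | D \<in> iso_classes (T \<uplus>\<^sub>T T') \<and> left_reduct ` D \<subseteq> C. \<xi> D)"

definition right_marginal :: "'p univ_theory \<Rightarrow> 'q univ_theory \<Rightarrow>
    (('p + 'q) rel_struct set \<Rightarrow> real) \<Rightarrow> 'q rel_struct set \<Rightarrow> real" where
  "right_marginal T T' \<xi> =
     (\<lambda>C\<in>iso_classes T'. \<Sum>D | D \<in> iso_classes (T \<uplus>\<^sub>T T') \<and> right_reduct ` D \<subseteq> C. \<xi> D)"

definition couplings :: "'p univ_theory \<Rightarrow> 'q univ_theory \<Rightarrow> ('p rel_struct set \<Rightarrow> real) \<Rightarrow>
    ('q rel_struct set \<Rightarrow> real) \<Rightarrow> (('p + 'q) rel_struct set \<Rightarrow> real) set" where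
  "couplings T T' \<phi> \<psi> = {\<xi> \<in> limit_objects (T \<uplus>\<^sub>T T').
     left_marginal T T' \<xi> = \<phi> \<and> right_marginal T T' \<xi> = \<psi>}"

text \<open>
  The requirement $(\phi\otimes\psi)(\langle K\rangle) = \phi(\langle K|_T\rangle)\,
  \psi(\langle K|_{T'}\rangle)$, solved for the value at the isomorphism class of \<open>K\<close>; the
  value does not depend on the chosen representative.
\<close>

definition indep_coupling :: "'p univ_theory \<Rightarrow> 'q univ_theory \<Rightarrow> ('p rel_struct set \<Rightarrow> real) \<Rightarrow>
    ('q rel_struct set \<Rightarrow> real) \<Rightarrow> ('p + 'q) rel_struct set \<Rightarrow> real" where
  "indep_coupling T T' \<phi> \<psi> = (\<lambda>C\<in>iso_classes (T \<uplus>\<^sub>T T').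
     let K = (SOME K. K \<in> C) in
       fact (card (verts K)) / real (card (Aut K)) *
       (labelled T \<phi> (left_reduct K) * labelled T' \<psi> (right_reduct K)))"

definition uniquely_coupleable :: "'p univ_theory \<Rightarrow> 'q univ_theory \<Rightarrow>
    ('p rel_struct set \<Rightarrow> real) \<Rightarrow> ('q rel_struct set \<Rightarrow> real) \<Rightarrow> bool" where
  "uniquely_coupleable T T' \<phi> \<psi> \<longleftrightarrow> couplings T T' \<phi> \<psi> = {indep_coupling T T' \<phi> \<psi>}"

section \<open>Theons and rank\<close>

definition atomless :: "'x measure \<Rightarrow> bool" where
  "atomless \<Omega> \<longleftrightarrow> (\<forall>A\<in>sets \<Omega>. 0 < emeasure \<Omega> A \<longrightarrow>
     (\<exists>B\<in>sets \<Omega>. B \<subseteq> A \<and> 0 < emeasure \<Omega> B \<and> emeasure \<Omega> B < emeasure \<Omega> A))"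

definition fin_nonempty :: "nat set \<Rightarrow> nat set set" where
  "fin_nonempty V = {A. A \<subseteq> V \<and> finite A \<and> A \<noteq> {}}"

text \<open>$\mathcal{E}_V(\Omega)$, with the completed product measure.\<close>

definition theon_space :: "nat set \<Rightarrow> 'x measure \<Rightarrow> (nat set \<Rightarrow> 'x) measure" where
  "theon_space V \<Omega> = completion (PiM (fin_nonempty V) (\<lambda>_. \<Omega>))"

text \<open>
  $\alpha^*(\theta)$, where the map $\alpha : [k] \to \mathbb{N}_+$ is given as the list of its
  values; $[k]$ is rendered as \<open>{..<k}\<close> and $\mathbb{N}_+$ as \<open>nat\<close>.
\<close>

definition pull :: "nat list \<Rightarrow> (nat set \<Rightarrow> 'x) \<Rightarrow> nat set \<Rightarrow> 'x" where
  "pull \<alpha> \<theta> = (\<lambda>A\<in>fin_nonempty {..<length \<alpha>}. \<theta> ((!) \<alpha> ` A))"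

definition theon_struct :: "'p univ_theory \<Rightarrow> ('p \<Rightarrow> (nat set \<Rightarrow> 'x) set) \<Rightarrow>
    (nat set \<Rightarrow> 'x) \<Rightarrow> 'p rel_struct" where
  "theon_struct T \<N> \<theta> = \<lparr>verts = UNIV, rels = (\<lambda>P. if P \<in> syms T
     then {\<alpha>. distinct \<alpha> \<and> length \<alpha> = ar T P \<and> pull \<alpha> \<theta> \<in> \<N> P} else {})\<rparr>"

definition is_theon :: "'x measure \<Rightarrow> 'p univ_theory \<Rightarrow>
    ('p \<Rightarrow> (nat set \<Rightarrow> 'x) set) \<Rightarrow> bool" where
  "is_theon \<Omega> T \<N> \<longleftrightarrow> (\<forall>P\<in>syms T. \<N> P \<in> sets (theon_space {..<ar T P} \<Omega>)) \<and>
     (AE \<theta> in theon_space UNIV \<Omega>. theon_struct T \<N> \<theta> \<in> models T)"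

definition theon_limit :: "'x measure \<Rightarrow> 'p univ_theory \<Rightarrow>
    ('p \<Rightarrow> (nat set \<Rightarrow> 'x) set) \<Rightarrow> 'p rel_struct set \<Rightarrow> real" where
  "theon_limit \<Omega> T \<N> = (\<lambda>C\<in>iso_classes T.
     measure (theon_space UNIV \<Omega>)
       {\<theta> \<in> space (theon_space UNIV \<Omega>).
          \<exists>M\<in>C. isomorphic M (induced (theon_struct T \<N> \<theta>) {..<card (verts M)})})"

definition peon_rank_le :: "'x measure \<Rightarrow> nat \<Rightarrow> (nat set \<Rightarrow> 'x) set \<Rightarrow> nat \<Rightarrow> bool" where
  "peon_rank_le \<Omega> k \<N> r \<longleftrightarrow>
     (\<exists>\<H> \<subseteq> PiE {A \<in> fin_nonempty {..<k}. card A \<le> r} (\<lambda>_. space \<Omega>).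
        \<N> = {x \<in> PiE (fin_nonempty {..<k}) (\<lambda>_. space \<Omega>).
               restrict x {A \<in> fin_nonempty {..<k}. card A \<le> r} \<in> \<H>})"

text \<open>
  Extended naturals make the infimum harmless when no theon represents \<open>\<phi>\<close>; for limit
  objects of canonical theories over an atomless \<open>\<Omega>\<close> this does not happen, and the infimum is a
  minimum.
\<close>

definition limit_rank :: "'x measure \<Rightarrow> 'p univ_theory \<Rightarrow> ('p rel_struct set \<Rightarrow> real) \<Rightarrow> enat" where
  "limit_rank \<Omega> T \<phi> = Inf {enat r | r. \<exists>\<N>. is_theon \<Omega> T \<N> \<and> theon_limit \<Omega> T \<N> = \<phi> \<and>
     (\<forall>P\<in>syms T. peon_rank_le \<Omega> (ar T P) (\<N> P) r)}"

section \<open>Unique coupleability and unique inducibility\<close>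

text \<open>
  A bound variable cannot range over types, so the predicate symbols of \<open>T'\<close> are natural
  numbers; up to renaming of symbols these are all finite relational languages.
\<close>

definition UCouple :: "'x measure \<Rightarrow> nat \<Rightarrow> 'p univ_theory \<Rightarrow> ('p rel_struct set \<Rightarrow> real) \<Rightarrow> bool"
  where
  "UCouple \<Omega> l T \<phi> \<longleftrightarrow>
     (\<forall>T' :: nat univ_theory. canonical_theory T' \<longrightarrow>
        (\<forall>\<psi>\<in>limit_objects T'. limit_rank \<Omega> T' \<psi> \<le> enat l \<longrightarrow> uniquely_coupleable T T' \<phi> \<psi>))"

definition UInduce :: "nat \<Rightarrow> 'p univ_theory \<Rightarrow> ('p rel_struct set \<Rightarrow> real) \<Rightarrow> bool" where
  "UInduce l T \<phi> \<longleftrightarrow> l = 0 \<or>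
     (\<forall>\<psi>'\<in>limit_objects (hypergraph_theory l).
      \<forall>\<xi>\<in>couplings T (hypergraph_theory l) \<phi> \<psi>'.
      \<forall>M\<in>finite_models (T \<uplus>\<^sub>T hypergraph_theory l).
        complete_hypergraph l (right_reduct M) \<longrightarrow>
        \<xi> (iso_class (T \<uplus>\<^sub>T hypergraph_theory l) M) =
          indep_coupling T (hypergraph_theory l) \<phi> \<psi>' (iso_class (T \<uplus>\<^sub>T hypergraph_theory l) M))"

end

theory Submission
  imports Defs
begin

text \<open>
  All linear orders on \<open>n\<close> points are isomorphic, hence the unique limit. A complete hypergraph on
  an ordered set has a unique isomorphism type and only the trivial automorphism, so its density
  is forced by the hypergraph marginal alone; this gives unique inducibility.

  For the failure of unique coupleability, pick an event \<open>A\<close> of probability \<open>p\<close> with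
  \<open>0 < p < 1\<close> and colour points red independently with probability \<open>p\<close>; this colouring has
  rank 1. Colouring an initial segment of proportion \<open>p\<close> of a long linear order has the same
  colour statistics, but in the limit a blue point never precedes a red one, whereas in the
  independent coupling this happens with positive probability.
\<close>

section \<open>Isomorphism and induced substructures\<close>

text \<open>The two properties differ in what they can see. Every bijection respects a complete
  hypergraph, so for complete \<open>M\<close> the positions of vertices in the order are invisible;
  for l = 1 completeness says that all vertices are red. \<open>UCouple\<close> also inspects mixed
  colourings, and there the order relates red points to blue ones.

  The obstacle is that a marginal is a sum over isomorphism classes, whereas the dependent coupling
  arises from a sequence of finite models. The two are reconciled by sorting the vertex subsets of a
  given size by the class they induce and passing to the limit inside the sum. That sum must be
  finite, which is why isomorphism classes of a given size over a finite language are counted.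
  Checking a coupling then reduces to density limits of the two reducts. Both
  \<open>indep_coupling\<close> and the dependent coupling read their values off a chosen
  representative, so each use has to compare that representative with the structure at hand.\<close>

lemma is_iso_sym:
  assumes "is_iso f M N"
  shows "is_iso (inv_into (verts M) f) N M"
proof -
  have f: "bij_betw f (verts M) (verts N)"
    and r: "\<And>P xs. set xs \<subseteq> verts M \<Longrightarrow> xs \<in> rels M P \<longleftrightarrow> map f xs \<in> rels N P"
    using assms by (auto simp: is_iso_def)
  let ?g = "inv_into (verts M) f"
  have g: "bij_betw ?g (verts N) (verts M)"
    using f by (rule bij_betw_inv_into)
  have "xs \<in> rels N P \<longleftrightarrow> map ?g xs \<in> rels M P" if "set xs \<subseteq> verts N" for P xs
  proof -
    have "map f (map ?g xs) = xs"
      using that f by (auto simp: bij_betw_def f_inv_into_f intro!: map_idI)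
    moreover have "set (map ?g xs) \<subseteq> verts M"
      using that g by (auto simp: bij_betw_def)
    ultimately show ?thesis
      using r[of "map ?g xs" P] by simp
  qed
  with g show ?thesis by (simp add: is_iso_def)
qed

lemma is_iso_trans:
  assumes "is_iso f M N" "is_iso g N K"
  shows "is_iso (g \<circ> f) M K"
proof -
  have "set (map f xs) \<subseteq> verts N" if "set xs \<subseteq> verts M" for xs
    using assms(1) that by (auto simp: is_iso_def bij_betw_def)
  then show ?thesis
    using assms by (auto simp: is_iso_def bij_betw_trans simp flip: map_map)
qed

lemma is_iso_id: "is_iso id M M"
  by (simp add: is_iso_def)

lemma isomorphic_refl: "isomorphic M M"
  using is_iso_id by (auto simp: isomorphic_def)

lemma isomorphic_sym: "isomorphic M N \<Longrightarrow> isomorphic N M"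
  using is_iso_sym by (auto simp: isomorphic_def)

lemma isomorphic_trans: "isomorphic M N \<Longrightarrow> isomorphic N K \<Longrightarrow> isomorphic M K"
  using is_iso_trans unfolding isomorphic_def by blast

lemma isomorphic_card: "isomorphic M N \<Longrightarrow> card (verts M) = card (verts N)"
  by (auto simp: isomorphic_def is_iso_def bij_betw_same_card)

lemma finite_models_models: "M \<in> finite_models T \<Longrightarrow> M \<in> models T"
  by (simp add: finite_models_def)

lemma finite_models_finite: "M \<in> finite_models T \<Longrightarrow> finite (verts M)"
  by (simp add: finite_models_def)

lemma equiv_iso_rel: "equiv (finite_models T) (iso_rel T)"
  by (auto intro!: equivI refl_onI symI transI simp: iso_rel_def isomorphic_refl
      intro: isomorphic_sym isomorphic_trans)

lemma in_iso_class_iff: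
  "M \<in> finite_models T \<Longrightarrow> K \<in> iso_class T M \<longleftrightarrow> K \<in> finite_models T \<and> isomorphic M K"
  by (auto simp: iso_class_def iso_rel_def)

lemma iso_class_self: "M \<in> finite_models T \<Longrightarrow> M \<in> iso_class T M"
  by (simp add: in_iso_class_iff isomorphic_refl)

lemma iso_class_in_classes: "M \<in> finite_models T \<Longrightarrow> iso_class T M \<in> iso_classes T"
  by (simp add: iso_class_def iso_classes_def quotientI)

lemma iso_class_eqI:
  assumes "M \<in> finite_models T" "N \<in> finite_models T" "isomorphic M N"
  shows "iso_class T M = iso_class T N"
  using equiv_class_eq[OF equiv_iso_rel, of M N T] assms by (auto simp: iso_class_def iso_rel_def)

lemma iso_class_eqD:
  assumes "N \<in> finite_models T" "iso_class T M = iso_class T N" "M \<in> finite_models T"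
  shows "isomorphic M N"
  using iso_class_self[OF assms(1)] assms(2,3) in_iso_class_iff by metis

lemma iso_classesE:
  assumes "C \<in> iso_classes T"
  obtains M where "M \<in> finite_models T" "C = iso_class T M"
  using assms by (auto simp: iso_classes_def iso_class_def quotient_def)

lemma some_in_iso_class:
  assumes "C \<in> iso_classes T"
  shows "(SOME K. K \<in> C) \<in> finite_models T" "iso_class T (SOME K. K \<in> C) = C"
proof -
  obtain M where M: "M \<in> finite_models T" "C = iso_class T M"
    using assms by (rule iso_classesE)
  then have "(SOME K. K \<in> C) \<in> C"
    using iso_class_self by (metis someI)
  then show "(SOME K. K \<in> C) \<in> finite_models T" "iso_class T (SOME K. K \<in> C) = C"
    using M iso_class_eqI in_iso_class_iff by metis+
qed

lemma verts_induced [simp]: "verts (induced M U) = U"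
  by (simp add: induced_def)

lemma holds_induced:
  assumes "range v \<subseteq> U"
  shows "holds (induced M U) v F \<longleftrightarrow> holds M v F"
  using assms by (induction F) (auto simp: induced_def)

lemma induced_in_models:
  assumes "M \<in> models T" "U \<subseteq> verts M"
  shows "induced M U \<in> models T"
proof -
  have "holds (induced M U) v F" if "F \<in> axs T" "range v \<subseteq> U" for F v
    using that assms by (subst holds_induced) (auto simp: models_def)
  moreover have "rels (induced M U) P \<subseteq> {xs. set xs \<subseteq> U \<and> length xs = ar T P}"
    if "P \<in> syms T" for P
    using that assms by (auto simp: models_def induced_def)
  ultimately show ?thesis
    using assms by (auto simp: models_def induced_def)
qed

lemma induced_in_finite_models:
  assumes "M \<in> finite_models T" "U \<subseteq> verts M"
  shows "induced M U \<in> finite_models T"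
  using assms by (auto simp: finite_models_def induced_in_models intro: finite_subset)

section \<open>Transport along isomorphisms and the number of isomorphism types\<close>

lemma is_iso_image_struct:
  assumes "inj_on f (verts M)" "\<And>P xs. xs \<in> rels M P \<Longrightarrow> set xs \<subseteq> verts M"
  shows "is_iso f M \<lparr>verts = f ` verts M, rels = (\<lambda>P. map f ` rels M P)\<rparr>"
proof -
  have "xs \<in> rels M P" if "set xs \<subseteq> verts M" "map f xs = map f ys" "ys \<in> rels M P" for P xs ys
  proof -
    have "inj_on f (set xs \<union> set ys)"
      using assms that by (meson inj_on_subset Un_least)
    then show ?thesis
      using inj_on_map_eq_map that by metis
  qed
  then show ?thesis
    using assms(1) by (auto simp: is_iso_def bij_betw_def)
qed

lemma models_rels_verts: "M \<in> models T \<Longrightarrow> xs \<in> rels M P \<Longrightarrow> set xs \<subseteq> verts M"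
  by (cases "P \<in> syms T") (auto simp: models_def)

lemma holds_is_iso:
  assumes "is_iso f M N" "range v \<subseteq> verts M"
  shows "holds N (f \<circ> v) F \<longleftrightarrow> holds M v F"
proof (induction F)
  case (Eq i j)
  have "inj_on f (verts M)"
    using assms(1) by (simp add: is_iso_def bij_betw_def)
  then show ?case
    using assms(2) by (auto dest: inj_onD)
next
  case (Atom P xs)
  have "set (map v xs) \<subseteq> verts M"
    using assms(2) by auto
  then show ?case
    using assms(1) by (simp add: is_iso_def comp_def)
qed auto

text \<open>\<open>is_iso\<close> constrains only tuples inside the vertex set of \<open>M\<close>,
  so tuples of \<open>N\<close> that leave its vertex set have to be excluded separately. With that,
  assignments into \<open>N\<close> are pulled back along the inverse of \<open>f\<close>.\<close>

lemma models_is_iso: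
  assumes f: "is_iso f M N" and M: "M \<in> models T"
    and N: "\<And>P xs. xs \<in> rels N P \<Longrightarrow> set xs \<subseteq> verts N"
  shows "N \<in> models T"
proof -
  have bij: "bij_betw f (verts M) (verts N)"
    using f by (simp add: is_iso_def)
  let ?g = "inv_into (verts M) f"
  have fg: "f (?g y) = y" "?g y \<in> verts M" if "y \<in> verts N" for y
    using that bij by (auto simp: bij_betw_def f_inv_into_f inv_into_into)
  have rel: "map ?g xs \<in> rels M P" if "xs \<in> rels N P" for P xs
    using is_iso_sym[OF f] N[OF that] that by (auto simp: is_iso_def)
  have "holds N v F" if "F \<in> axs T" "range v \<subseteq> verts N" for v F
  proof -
    have "f \<circ> (?g \<circ> v) = v" "range (?g \<circ> v) \<subseteq> verts M"
      using that(2) fg by (auto simp: fun_eq_iff)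
    then show ?thesis
      using holds_is_iso[OF f, of "?g \<circ> v" F] M that(1) by (auto simp: models_def)
  qed
  moreover have "length xs = ar T P" if "P \<in> syms T" "xs \<in> rels N P" for P xs
    using rel[OF that(2)] that(1) M by (force simp: models_def)
  moreover have "rels N P = {}" if "P \<notin> syms T" for P
    using rel that M by (fastforce simp: models_def)
  ultimately show ?thesis
    unfolding models_def using N by blast
qed

text \<open>Each class of size \<open>m\<close> has a representative on \<open>{..<m}\<close>, and a
  finite language admits only finitely many structures there. This makes the sums in the marginals
  finite.\<close>

lemma finite_iso_classes_card:
  assumes "finite (syms T)"
  shows "finite {C \<in> iso_classes T. \<exists>M\<in>C. card (verts M) = m}"
proof -
  define X where "X = (\<lambda>r. \<lparr>verts = {..<m}, rels = r\<rparr>) ` {r. \<forall>P.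
    (P \<in> syms T \<longrightarrow> r P \<in> Pow {xs. set xs \<subseteq> {..<m} \<and> length xs = ar T P}) \<and>
    (P \<notin> syms T \<longrightarrow> r P = {})}"
  \<comment> \<open>The possible values of \<open>r P\<close> depend on the arity of
    \<open>P\<close>; \<open>Y\<close> merges them into the single finite codomain that
    \<open>finite_set_of_finite_funs\<close> asks for.\<close>
  define Y where "Y = (\<Union>P\<in>syms T. Pow {xs. set xs \<subseteq> {..<m} \<and> length xs = ar T P})"
  have "finite Y"
    using assms by (simp add: Y_def finite_lists_length_eq)
  then have "finite {r. \<forall>P. (P \<in> syms T \<longrightarrow> r P \<in> Y) \<and> (P \<notin> syms T \<longrightarrow> r P = {})}"
    by (rule finite_set_of_finite_funs[OF assms])
  then have "finite X"
    unfolding X_def by (rule finite_imageI[OF finite_subset[rotated]]) (auto simp: Y_def)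
  moreover have "{C \<in> iso_classes T. \<exists>M\<in>C. card (verts M) = m} \<subseteq> iso_class T ` X"
  proof safe
    fix C M assume C: "C \<in> iso_classes T" "M \<in> C" and m: "m = card (verts M)"
    from C obtain M' where M': "M' \<in> finite_models T" "C = iso_class T M'"
      by (auto elim: iso_classesE)
    then have M: "M \<in> finite_models T" "C = iso_class T M"
      using C iso_class_eqI in_iso_class_iff by metis+
    then obtain f where f: "bij_betw f (verts M) {..<m}"
      unfolding m using ex_bij_betw_finite_nat finite_models_finite
      by (metis atLeast0LessThan)
    have rM: "\<And>P xs. xs \<in> rels M P \<Longrightarrow> set xs \<subseteq> verts M"
      using models_rels_verts[OF finite_models_models[OF M(1)]] .
    let ?N = "\<lparr>verts = f ` verts M, rels = (\<lambda>P. map f ` rels M P)\<rparr>"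
    have i: "is_iso f M ?N"
      using f rM by (intro is_iso_image_struct) (auto simp: bij_betw_def)
    have "?N \<in> models T"
      using rM by (intro models_is_iso[OF i finite_models_models[OF M(1)]]) fastforce
    moreover have "f ` verts M = {..<m}"
      using f by (simp add: bij_betw_def)
    ultimately have N: "?N \<in> finite_models T" "?N \<in> X"
      by (auto simp: finite_models_def X_def models_def intro!: imageI)
    moreover have "C = iso_class T ?N"
      using iso_class_eqI[OF M(1) N(1)] i M(2) unfolding isomorphic_def by blast
    ultimately show "C \<in> iso_class T ` X" by blast
  qed
  ultimately show ?thesis
    by (meson finite_imageI finite_subset)
qed

section \<open>Reducts and marginals\<close>

lemma verts_reduct [simp]: "verts (left_reduct M) = verts M" "verts (right_reduct M) = verts M"
  by (simp_all add: left_reduct_def right_reduct_def)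

lemma rels_reduct [simp]:
  "rels (left_reduct M) P = rels M (Inl P)" "rels (right_reduct M) Q = rels M (Inr Q)"
  by (simp_all add: left_reduct_def right_reduct_def)

lemma induced_reduct:
  "left_reduct (induced M U) = induced (left_reduct M) U"
  "right_reduct (induced M U) = induced (right_reduct M) U"
  by (simp_all add: induced_def left_reduct_def right_reduct_def)

lemma holds_reduct:
  "holds (left_reduct M) v F \<longleftrightarrow> holds M v (map_qf_form Inl F)"
  "holds (right_reduct M) v G \<longleftrightarrow> holds M v (map_qf_form Inr G)"
  by (induction F; simp) (induction G; simp)

lemma models_disj_union_iff:
  "M \<in> models (T \<uplus>\<^sub>T T') \<longleftrightarrow> left_reduct M \<in> models T \<and> right_reduct M \<in> models T'"
  unfolding models_def disj_union_def
  by (simp add: ball_Un holds_reduct split_sum_all Plus_def image_iff) auto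

lemma finite_models_disj_union_iff:
  "M \<in> finite_models (T \<uplus>\<^sub>T T') \<longleftrightarrow>
     left_reduct M \<in> finite_models T \<and> right_reduct M \<in> finite_models T'"
  by (auto simp: finite_models_def models_disj_union_iff)

lemma is_iso_disj_union_iff:
  "is_iso f M N \<longleftrightarrow>
     is_iso f (left_reduct M) (left_reduct N) \<and> is_iso f (right_reduct M) (right_reduct N)"
  by (auto simp: is_iso_def split_sum_all)

lemma isomorphic_reduct:
  assumes "isomorphic M N"
  shows "isomorphic (left_reduct M) (left_reduct N)"
    and "isomorphic (right_reduct M) (right_reduct N)"
  using assms by (auto simp: isomorphic_def is_iso_disj_union_iff)

text \<open>Sort the vertex sets \<open>U\<close> on which the reduct of \<open>N\<close> induces a
  copy of \<open>M\<close> by the class of \<open>induced N U\<close>: each falls under exactly one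
  \<open>D\<close> in \<open>I\<close>, and all these classes have the size of \<open>M\<close>, so
  the denominators agree. The abstract \<rho> lets one proof serve both reducts.\<close>

lemma density_reduct:
  assumes verts_\<rho>: "\<And>K. verts (\<rho> K) = verts K"
    and induced_\<rho>: "\<And>K U. \<rho> (induced K U) = induced (\<rho> K) U"
    and iso_\<rho>: "\<And>K L. isomorphic K L \<Longrightarrow> isomorphic (\<rho> K) (\<rho> L)"
    and models_\<rho>: "\<And>K. K \<in> finite_models S \<Longrightarrow> \<rho> K \<in> finite_models T"
    and fin: "finite (syms S)"
    and M: "M \<in> finite_models T" and N: "N \<in> finite_models S"
  defines "I \<equiv> {D \<in> iso_classes S. \<rho> ` D \<subseteq> iso_class T M}"
  shows "finite I" and "density M (\<rho> N) = (\<Sum>D\<in>I. density (SOME K. K \<in> D) N)"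
proof -
  let ?s = "\<lambda>D. SOME K. K \<in> D"
  let ?A = "\<lambda>D. {U. U \<subseteq> verts N \<and> card U = card (verts (?s D)) \<and> isomorphic (?s D) (induced N U)}"
  have s: "?s D \<in> finite_models S" "iso_class S (?s D) = D" if "D \<in> I" for D
    using that some_in_iso_class[of D S] by (simp_all add: I_def)
  have sM: "isomorphic M (\<rho> (?s D))" if "D \<in> I" for D
  proof -
    have "?s D \<in> D"
      using s[OF that] iso_class_self by metis
    then show ?thesis
      using that M by (auto simp: I_def in_iso_class_iff)
  qed
  have card_s: "card (verts (?s D)) = card (verts M)" if "D \<in> I" for D
    using isomorphic_card[OF sM[OF that]] by (simp add: verts_\<rho>)
  have "I \<subseteq> {C \<in> iso_classes S. \<exists>K\<in>C. card (verts K) = card (verts M)}"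
  proof
    fix D assume D: "D \<in> I"
    then have "?s D \<in> D"
      using s iso_class_self by metis
    with D card_s show "D \<in> {C \<in> iso_classes S. \<exists>K\<in>C. card (verts K) = card (verts M)}"
      by (auto simp: I_def)
  qed
  then show finI: "finite I"
    using finite_iso_classes_card[OF fin] finite_subset by blast
  have "{U. U \<subseteq> verts (\<rho> N) \<and> card U = card (verts M) \<and> isomorphic M (induced (\<rho> N) U)}
        = (\<Union>D\<in>I. ?A D)" (is "?L = ?R")
  proof (intro equalityI subsetI)
    fix U assume "U \<in> ?L"
    then have U: "U \<subseteq> verts N" "card U = card (verts M)" "isomorphic M (\<rho> (induced N U))"
      by (auto simp: verts_\<rho> induced_\<rho>)
    let ?D = "iso_class S (induced N U)"
    have NU: "induced N U \<in> finite_models S"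
      using N U induced_in_finite_models by blast
    have "\<rho> ` ?D \<subseteq> iso_class T M"
      using U(3) NU M isomorphic_trans[OF _ iso_\<rho>] by (auto simp: in_iso_class_iff models_\<rho>)
    then have D: "?D \<in> I"
      by (simp add: I_def iso_class_in_classes NU)
    moreover have "isomorphic (?s ?D) (induced N U)"
      using s[OF D] NU iso_class_eqD by blast
    ultimately have "U \<in> ?A ?D"
      using U card_s[OF D] by auto
    with D show "U \<in> ?R" by blast
  next
    fix U assume "U \<in> ?R"
    then obtain D where D: "D \<in> I" and U: "U \<in> ?A D"
      by blast
    then have "isomorphic M (\<rho> (induced N U))"
      using sM iso_\<rho> isomorphic_trans by blast
    then show "U \<in> ?L"
      using U card_s[OF D] by (auto simp: verts_\<rho> induced_\<rho>)
  qed
  \<comment> \<open>A set \<open>U\<close> determines the class of its induced structure, so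
    different classes count disjoint families.\<close>
  moreover have "card (\<Union>D\<in>I. ?A D) = (\<Sum>D\<in>I. card (?A D))"
  proof (rule card_UN_disjoint[OF finI])
    show "\<forall>D\<in>I. finite (?A D)"
      using finite_models_finite[OF N] by auto
    have "D = E" if "D \<in> I" "E \<in> I" "U \<in> ?A D" "U \<in> ?A E" for D E U
    proof -
      have "isomorphic (?s D) (?s E)"
        using that(3,4) isomorphic_sym isomorphic_trans by blast
      then show ?thesis
        using iso_class_eqI s that(1,2) by metis
    qed
    then show "\<forall>D\<in>I. \<forall>E\<in>I. D \<noteq> E \<longrightarrow> ?A D \<inter> ?A E = {}"
      by blast
  qed
  ultimately show "density M (\<rho> N) = (\<Sum>D\<in>I. density (?s D) N)"
    by (simp add: density_def verts_\<rho> card_s sum_divide_distrib)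
qed

text \<open>The limit passes through the finite sum of \<open>density_reduct\<close>, so a marginal
  of \<xi> is the limit of the densities in the reducts.\<close>

lemma limit_reduct:
  assumes \<xi>: "\<And>K. K \<in> finite_models S \<Longrightarrow> (\<lambda>n. density K (N n)) \<longlonglongrightarrow> \<xi> (iso_class S K)"
    and N: "\<And>n. N n \<in> finite_models S"
    and \<rho>: "\<And>K. verts (\<rho> K) = verts K" "\<And>K U. \<rho> (induced K U) = induced (\<rho> K) U"
      "\<And>K L. isomorphic K L \<Longrightarrow> isomorphic (\<rho> K) (\<rho> L)"
      "\<And>K. K \<in> finite_models S \<Longrightarrow> \<rho> K \<in> finite_models T"
    and fin: "finite (syms S)" and M: "M \<in> finite_models T"
  shows "(\<lambda>n. density M (\<rho> (N n))) \<longlonglongrightarrow>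
    (\<Sum>D | D \<in> iso_classes S \<and> \<rho> ` D \<subseteq> iso_class T M. \<xi> D)"
proof -
  note density_reduct(2)[where \<rho> = \<rho>, OF \<rho> fin M N]
  moreover have "(\<lambda>n. density (SOME K. K \<in> D) (N n)) \<longlonglongrightarrow> \<xi> D" if "D \<in> iso_classes S" for D
    using \<xi>[of "SOME K. K \<in> D"] some_in_iso_class[OF that] by simp
  ultimately show ?thesis
    by (auto intro!: tendsto_sum)
qed

text \<open>Reduct densities converge both to the marginals of \<xi> and to the prescribed limits,
  so uniqueness of limits gives the marginal conditions. Extensionality settles the arguments that
  are not isomorphism classes.\<close>

lemma couplingsI:
  assumes \<xi>: "\<xi> \<in> iso_classes (T \<uplus>\<^sub>T T') \<rightarrow>\<^sub>E {0..1}"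
    and N: "\<And>n. N n \<in> finite_models (T \<uplus>\<^sub>T T')"
    and mono: "strict_mono (\<lambda>n. card (verts (N n)))"
    and lim: "\<And>K. K \<in> finite_models (T \<uplus>\<^sub>T T') \<Longrightarrow>
      (\<lambda>n. density K (N n)) \<longlonglongrightarrow> \<xi> (iso_class (T \<uplus>\<^sub>T T') K)"
    and fin: "finite (syms T)" "finite (syms T')"
    and \<phi>: "\<phi> \<in> extensional (iso_classes T)" and \<psi>: "\<psi> \<in> extensional (iso_classes T')"
    and lim_\<phi>: "\<And>M. M \<in> finite_models T \<Longrightarrow>
      (\<lambda>n. density M (left_reduct (N n))) \<longlonglongrightarrow> \<phi> (iso_class T M)"
    and lim_\<psi>: "\<And>M. M \<in> finite_models T' \<Longrightarrow>
      (\<lambda>n. density M (right_reduct (N n))) \<longlonglongrightarrow> \<psi> (iso_class T' M)"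
  shows "\<xi> \<in> couplings T T' \<phi> \<psi>"
proof -
  have finS: "finite (syms (T \<uplus>\<^sub>T T'))"
    using fin by (simp add: disj_union_def)
  have left: "(\<lambda>n. density M (left_reduct (N n))) \<longlonglongrightarrow>
    (\<Sum>D | D \<in> iso_classes (T \<uplus>\<^sub>T T') \<and> left_reduct ` D \<subseteq> iso_class T M. \<xi> D)"
    if "M \<in> finite_models T" for M
    by (rule limit_reduct[where N = N, OF lim N])
      (auto simp: that finS induced_reduct isomorphic_reduct finite_models_disj_union_iff)
  have right: "(\<lambda>n. density M (right_reduct (N n))) \<longlonglongrightarrow>
    (\<Sum>D | D \<in> iso_classes (T \<uplus>\<^sub>T T') \<and> right_reduct ` D \<subseteq> iso_class T' M. \<xi> D)"
    if "M \<in> finite_models T'" for M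
    by (rule limit_reduct[where N = N, OF lim N])
      (auto simp: that finS induced_reduct isomorphic_reduct finite_models_disj_union_iff)
  have "left_marginal T T' \<xi> C = \<phi> C" for C
    using LIMSEQ_unique[OF left lim_\<phi>] \<phi>
    by (cases "C \<in> iso_classes T")
      (auto simp: left_marginal_def extensional_def elim!: iso_classesE)
  moreover have "right_marginal T T' \<xi> C = \<psi> C" for C
    using LIMSEQ_unique[OF right lim_\<psi>] \<psi>
    by (cases "C \<in> iso_classes T'")
      (auto simp: right_marginal_def extensional_def elim!: iso_classesE)
  ultimately show ?thesis
    using \<xi> N mono lim by (auto simp: couplings_def limit_objects_def fun_eq_iff intro!: exI[of _ N])
qed

section \<open>Linear orders\<close>

definition order_rank :: "unit rel_struct \<Rightarrow> nat \<Rightarrow> nat" where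
  "order_rank M x = card {y. [y, x] \<in> rels M ()}"

context
  fixes M :: "unit rel_struct"
  assumes M: "M \<in> finite_models lin_order_theory"
begin

lemma lin_order_rels:
  assumes "xs \<in> rels M P"
  obtains x y where "xs = [x, y]" "x \<in> verts M" "y \<in> verts M"
proof -
  have "set xs \<subseteq> verts M \<and> length xs = 2"
    using M assms by (auto simp: finite_models_def models_def lin_order_theory_def)
  then show ?thesis
    using that by (auto simp: length_Suc_conv numeral_2_eq_2)
qed

text \<open>The axioms use only the variables 0, 1 and 2, so three values suffice to instantiate any
  of them; \<open>z\<close> also fills the remaining variables, keeping the range inside the vertex
  set.\<close>

lemma lin_order_holds:
  assumes "F \<in> axs lin_order_theory" "x \<in> verts M" "y \<in> verts M" "z \<in> verts M"
  shows "holds M (\<lambda>i. if i = 0 then x else if i = 1 then y else z) F"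
proof -
  let ?v = "\<lambda>i. if i = 0 then x else if i = 1 then y else z"
  have "range ?v \<subseteq> verts M"
    using assms by auto
  moreover have "\<forall>v. range v \<subseteq> verts M \<longrightarrow> holds M v F"
    using M assms by (auto simp: finite_models_def models_def)
  ultimately show ?thesis by blast
qed

lemma lin_order_irrefl: "[x, x] \<notin> rels M ()"
proof
  assume r: "[x, x] \<in> rels M ()"
  then have "x \<in> verts M"
    by (auto elim: lin_order_rels)
  then show False
    using lin_order_holds[of "Neg (Atom () [0, 0])" x x x] r by (simp add: lin_order_theory_def)
qed

lemma lin_order_total:
  assumes "x \<in> verts M" "y \<in> verts M" "x \<noteq> y"
  shows "[x, y] \<in> rels M () \<or> [y, x] \<in> rels M ()"
  using lin_order_holds[of "Imp (Neg (Eq 0 1)) (Disj (Atom () [0, 1]) (Atom () [1, 0]))" x y y] assms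
  by (simp add: lin_order_theory_def)

lemma lin_order_trans:
  assumes "[x, y] \<in> rels M ()" "[y, z] \<in> rels M ()"
  shows "[x, z] \<in> rels M ()"
proof -
  have "x \<in> verts M" "y \<in> verts M" "z \<in> verts M"
    using assms by (auto elim: lin_order_rels)
  then show ?thesis
    using lin_order_holds[of "Imp (Conj (Atom () [0, 1]) (Atom () [1, 2])) (Atom () [0, 2])" x y z]
      assms by (simp add: lin_order_theory_def)
qed

lemma lin_order_below: "{y. [y, x] \<in> rels M ()} \<subseteq> verts M - {x}"
  using lin_order_irrefl by (auto elim: lin_order_rels)

lemma rank_less:
  assumes "[x, y] \<in> rels M ()"
  shows "order_rank M x < order_rank M y"
  unfolding order_rank_def
proof (rule psubset_card_mono)
  show "finite {z. [z, y] \<in> rels M ()}"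
    using lin_order_below[of y] finite_models_finite[OF M] by (meson finite_Diff finite_subset)
  show "{z. [z, x] \<in> rels M ()} \<subset> {z. [z, y] \<in> rels M ()}"
    using assms lin_order_trans[OF _ assms] lin_order_irrefl[of x] by blast
qed

lemma rank_less_iff:
  assumes "x \<in> verts M" "y \<in> verts M"
  shows "order_rank M x < order_rank M y \<longleftrightarrow> [x, y] \<in> rels M ()"
  using rank_less[of x y] rank_less[of y x] lin_order_total[OF assms] by force

text \<open>Totality makes ranks distinct, and no vertex is its own predecessor, so ranks stay below
  the size. An injection between finite sets of equal size is onto.\<close>

lemma bij_betw_rank: "bij_betw (order_rank M) (verts M) {..<card (verts M)}"
proof -
  have inj: "inj_on (order_rank M) (verts M)"
    using lin_order_total rank_less by (fastforce simp: inj_on_def)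
  have "order_rank M x < card (verts M)" if "x \<in> verts M" for x
    unfolding order_rank_def
    using lin_order_below[of x] that finite_models_finite[OF M] by (intro psubset_card_mono) auto
  then have "order_rank M ` verts M = {..<card (verts M)}"
    using inj by (intro card_subset_eq) (auto simp: card_image)
  with inj show ?thesis
    by (simp add: bij_betw_def)
qed

text \<open>A vertex of \<open>A\<close> has all its predecessors in \<open>A\<close>, and itself as
  a further element; a vertex outside has all of \<open>A\<close> below it. Hence an initial segment
  can be recovered from its size alone.\<close>

lemma initial_segment_rank:
  assumes A: "A \<subseteq> verts M" and init: "\<And>x y. x \<in> A \<Longrightarrow> y \<in> verts M - A \<Longrightarrow> [x, y] \<in> rels M ()"
    and x: "x \<in> verts M"
  shows "x \<in> A \<longleftrightarrow> order_rank M x < card A"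
proof
  have fin: "finite A" "finite {y. [y, x] \<in> rels M ()}"
    using A lin_order_below[of x] finite_models_finite[OF M] by (meson finite_Diff finite_subset)+
  show "order_rank M x < card A" if "x \<in> A"
    unfolding order_rank_def
  proof (rule psubset_card_mono[OF fin(1)])
    have "y \<in> A" if "[y, x] \<in> rels M ()" for y
    proof (rule ccontr)
      assume "y \<notin> A"
      moreover have "y \<in> verts M"
        using that by (auto elim: lin_order_rels)
      ultimately have "[x, y] \<in> rels M ()"
        using init \<open>x \<in> A\<close> by blast
      then show False
        using that lin_order_trans lin_order_irrefl by blast
    qed
    then show "{y. [y, x] \<in> rels M ()} \<subset> A"
      using lin_order_irrefl[of x] \<open>x \<in> A\<close> by blast
  qed
  show "x \<in> A" if "order_rank M x < card A"
  proof (rule ccontr)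
    assume "x \<notin> A"
    then have "A \<subseteq> {y. [y, x] \<in> rels M ()}"
      using init x by blast
    then have "card A \<le> order_rank M x"
      unfolding order_rank_def by (rule card_mono[OF fin(2)])
    with that show False by simp
  qed
qed

end

section \<open>Rigidity of finite linear orders\<close>

lemma is_iso_rank:
  assumes M: "M \<in> finite_models lin_order_theory" and N: "N \<in> finite_models lin_order_theory"
    and f: "is_iso f M N" and x: "x \<in> verts M"
  shows "order_rank N (f x) = order_rank M x"
proof -
  have bij: "bij_betw f (verts M) (verts N)"
    and r: "\<And>y z. y \<in> verts M \<Longrightarrow> z \<in> verts M \<Longrightarrow> [y, z] \<in> rels M () \<longleftrightarrow> [f y, f z] \<in> rels N ()"
    using f by (auto simp: is_iso_def)
  have "{y. [y, f x] \<in> rels N ()} = f ` {y. [y, x] \<in> rels M ()}"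
  proof (intro equalityI subsetI)
    fix y assume y: "y \<in> {y. [y, f x] \<in> rels N ()}"
    then have "y \<in> verts N"
      using lin_order_below[OF N] by blast
    then obtain z where "z \<in> verts M" "y = f z"
      using bij by (auto simp: bij_betw_def)
    then show "y \<in> f ` {y. [y, x] \<in> rels M ()}"
      using y r x by auto
  next
    fix y assume "y \<in> f ` {y. [y, x] \<in> rels M ()}"
    then show "y \<in> {y. [y, f x] \<in> rels N ()}"
      using r x lin_order_below[OF M] by fastforce
  qed
  moreover have "inj_on f {y. [y, x] \<in> rels M ()}"
    using bij lin_order_below[OF M, of x] by (auto simp: bij_betw_def intro: inj_on_subset)
  ultimately show ?thesis
    by (simp add: order_rank_def card_image)
qed

lemma lin_order_is_isoI:
  assumes M: "M \<in> finite_models lin_order_theory" and N: "N \<in> finite_models lin_order_theory"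
    and f: "bij_betw f (verts M) (verts N)" "\<And>x. x \<in> verts M \<Longrightarrow> order_rank N (f x) = order_rank M x"
  shows "is_iso f M N"
proof -
  have r: "[x, y] \<in> rels M () \<longleftrightarrow> [f x, f y] \<in> rels N ()" if "x \<in> verts M" "y \<in> verts M" for x y
    using rank_less_iff[OF M that] rank_less_iff[OF N, of "f x" "f y"] that f
    by (auto simp: bij_betw_def)
  have "xs \<in> rels M P \<longleftrightarrow> map f xs \<in> rels N P" if xs: "set xs \<subseteq> verts M" for P xs
  proof
    assume m: "xs \<in> rels M P"
    obtain x y where "xs = [x, y]" "x \<in> verts M" "y \<in> verts M"
      by (rule lin_order_rels[OF M m])
    then show "map f xs \<in> rels N P"
      using m r xs by auto
  next
    assume m: "map f xs \<in> rels N P"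
    obtain x y where "map f xs = [x, y]" "x \<in> verts N" "y \<in> verts N"
      by (rule lin_order_rels[OF N m])
    then show "xs \<in> rels M P"
      using m r xs by (auto simp: map_eq_Cons_conv)
  qed
  with f show ?thesis
    by (simp add: is_iso_def)
qed

text \<open>Both rank maps are bijections onto the same initial segment of the naturals; compose one
  with the inverse of the other.\<close>

lemma lin_order_iso_exists:
  assumes M: "M \<in> finite_models lin_order_theory" and N: "N \<in> finite_models lin_order_theory"
    and "card (verts M) = card (verts N)"
  obtains f where "is_iso f M N"
proof -
  define f where "f = inv_into (verts N) (order_rank N) \<circ> order_rank M"
  have "bij_betw f (verts M) (verts N)"
    unfolding f_def using bij_betw_rank[OF M] bij_betw_inv_into[OF bij_betw_rank[OF N]] assms(3)
    by (metis bij_betw_trans)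
  moreover have "order_rank N (f x) = order_rank M x" if "x \<in> verts M" for x
  proof -
    have "order_rank M x \<in> order_rank N ` verts N"
      using bij_betw_rank[OF M] bij_betw_rank[OF N] assms(3) that unfolding bij_betw_def by auto
    then show ?thesis
      by (simp add: f_def f_inv_into_f)
  qed
  ultimately show ?thesis
    using lin_order_is_isoI[OF M N] that by blast
qed

text \<open>An automorphism preserves ranks, and ranks are injective on vertices.\<close>

lemma lin_order_Aut:
  assumes M: "M \<in> finite_models lin_order_theory"
  shows "Aut M = {id}"
proof -
  have "f x = x" if f: "f permutes verts M" "is_iso f M M" for f x
  proof (cases "x \<in> verts M")
    case True
    then have "order_rank M (f x) = order_rank M x" "f x \<in> verts M"
      using is_iso_rank[OF M M f(2)] f(1) by (auto simp: permutes_in_image)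
    then show ?thesis
      using True bij_betw_rank[OF M] by (auto simp: bij_betw_def dest: inj_onD)
  qed (use f(1) in \<open>simp add: permutes_not_in\<close>)
  then show ?thesis
    by (auto simp: Aut_def permutes_id is_iso_id)
qed

section \<open>The unique limit of linear orders\<close>

definition nat_order :: "nat \<Rightarrow> unit rel_struct" where
  "nat_order n = \<lparr>verts = {..<n}, rels = \<lambda>_. {[x, y] | x y. x < y \<and> y < n}\<rparr>"

lemma nat_order_model: "nat_order n \<in> finite_models lin_order_theory"
  by (auto simp: nat_order_def finite_models_def models_def lin_order_theory_def canonical_axs_def
      upt_rec numeral_2_eq_2 less_Suc_eq)

text \<open>Every vertex subset of the right size induces a copy of \<open>M\<close>. The size bound
  keeps the binomial coefficient nonzero; beyond it the quotient is 0 / 0 and takes the default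
  value 0.\<close>

lemma lin_order_density:
  assumes M: "M \<in> finite_models lin_order_theory" and N: "N \<in> finite_models lin_order_theory"
    and le: "card (verts M) \<le> card (verts N)"
  shows "density M N = 1"
proof -
  have "isomorphic M (induced N U)" if "U \<subseteq> verts N" "card U = card (verts M)" for U
    using lin_order_iso_exists[OF M induced_in_finite_models[OF N that(1)]] that(2)
    by (auto simp: isomorphic_def)
  then have "{U. U \<subseteq> verts N \<and> card U = card (verts M) \<and> isomorphic M (induced N U)} =
    {U. U \<subseteq> verts N \<and> card U = card (verts M)}"
    by blast
  then show ?thesis
    using le finite_models_finite[OF N] by (simp add: density_def n_subsets)
qed

lemma lin_order_density_limit:
  assumes N: "\<And>n. N n \<in> finite_models lin_order_theory"
    and mono: "strict_mono (\<lambda>n. card (verts (N n)))" and M: "M \<in> finite_models lin_order_theory"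
  shows "(\<lambda>n. density M (N n)) \<longlonglongrightarrow> 1"
proof (rule tendsto_eventually)
  have "\<forall>\<^sub>F n in sequentially. card (verts M) \<le> card (verts (N n))"
    using filterlim_subseq[OF mono] by (simp add: filterlim_at_top)
  then show "\<forall>\<^sub>F n in sequentially. density M (N n) = 1"
    by (rule eventually_mono) (rule lin_order_density[OF M N])
qed

lemma limit_objects_lin_order:
  "limit_objects lin_order_theory = {\<lambda>C\<in>iso_classes lin_order_theory. 1}"
proof -
  note lim = lin_order_density_limit
  have "strict_mono (\<lambda>n. card (verts (nat_order n)))"
    by (simp add: nat_order_def strict_mono_def)
  then have "(\<lambda>C\<in>iso_classes lin_order_theory. 1) \<in> limit_objects lin_order_theory"
    using nat_order_model lim[OF nat_order_model]
    by (auto simp: limit_objects_def iso_class_in_classes intro!: exI[of _ nat_order])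
  moreover have "\<psi> = (\<lambda>C\<in>iso_classes lin_order_theory. 1)"
    if "\<psi> \<in> limit_objects lin_order_theory" for \<psi>
  proof
    from that obtain N where \<psi>: "\<psi> \<in> extensional (iso_classes lin_order_theory)"
      and N: "\<And>n. N n \<in> finite_models lin_order_theory" "strict_mono (\<lambda>n. card (verts (N n)))"
      and \<psi>_lim: "\<And>M. M \<in> finite_models lin_order_theory \<Longrightarrow>
        (\<lambda>n. density M (N n)) \<longlonglongrightarrow> \<psi> (iso_class lin_order_theory M)"
      unfolding limit_objects_def PiE_def by blast
    fix C show "\<psi> C = (\<lambda>C\<in>iso_classes lin_order_theory. 1) C"
      using LIMSEQ_unique[OF \<psi>_lim lim[OF N]] \<psi>
      by (cases "C \<in> iso_classes lin_order_theory") (auto simp: extensional_def elim!: iso_classesE)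
  qed
  ultimately show ?thesis by blast
qed


section \<open>Unique inducibility\<close>

lemma hypergraph_rels:
  assumes M: "M \<in> models (hypergraph_theory l)" and xs: "xs \<in> rels M P"
  shows "set xs \<subseteq> verts M" "length xs = l" "distinct xs"
proof -
  show sub: "set xs \<subseteq> verts M" and len: "length xs = l"
    using assms by (auto simp: models_def hypergraph_theory_def)
  show "distinct xs"
  proof (rule ccontr)
    assume "\<not> distinct xs"
    then obtain i j where ij: "i < j" "j < l" "xs ! i = xs ! j"
      using len by (metis distinct_conv_nth nat_neq_iff)
    \<comment> \<open>Variables from \<open>l\<close> on receive the default \<open>xs ! 0\<close>,
      which is a vertex because i < j < l makes the list nonempty.\<close>
    define v where "v = (\<lambda>k. if k < l then xs ! k else xs ! 0)"
    have "range v \<subseteq> verts M"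
      using sub len ij by (auto simp: v_def intro!: subsetD[OF sub] nth_mem)
    moreover have "Imp (Eq i j) (Neg (Atom () [0..<l])) \<in> axs (hypergraph_theory l)"
      using ij by (auto simp: hypergraph_theory_def canonical_axs_def)
    ultimately have "holds M v (Imp (Eq i j) (Neg (Atom () [0..<l])))"
      using M by (auto simp: models_def)
    moreover have "map v [0..<l] = xs"
      using len by (auto simp: v_def intro: nth_equalityI)
    ultimately show False
      using ij xs by (simp add: v_def)
  qed
qed

lemma complete_hypergraph_rels:
  assumes "M \<in> models (hypergraph_theory l)" "complete_hypergraph l M"
  shows "rels M P = {xs. set xs \<subseteq> verts M \<and> length xs = l \<and> distinct xs}"
proof (intro set_eqI iffI)
  fix xs assume "xs \<in> {xs. set xs \<subseteq> verts M \<and> length xs = l \<and> distinct xs}"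
  then show "xs \<in> rels M P"
    using assms(2) by (simp add: complete_hypergraph_def)
qed (simp add: hypergraph_rels[OF assms(1)])

text \<open>The edge relation of a complete hypergraph is determined by its vertex set, so
  bijectivity is the only requirement left.\<close>

lemma complete_hypergraph_is_iso:
  assumes "M \<in> models (hypergraph_theory l)" "complete_hypergraph l M"
    and "N \<in> models (hypergraph_theory l)" "complete_hypergraph l N"
    and f: "bij_betw f (verts M) (verts N)"
  shows "is_iso f M N"
proof -
  have "f ` set xs \<subseteq> verts N" "inj_on f (set xs)" if "set xs \<subseteq> verts M" for xs
    using f that by (auto simp: bij_betw_def intro: inj_on_subset)
  then show ?thesis
    using f by (auto simp: is_iso_def complete_hypergraph_rels[OF assms(1,2)]
        complete_hypergraph_rels[OF assms(3,4)] distinct_map)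
qed

lemma isomorphic_complete_hypergraph:
  assumes M: "M \<in> models (hypergraph_theory l)" "complete_hypergraph l M"
    and N: "N \<in> models (hypergraph_theory l)" and "isomorphic M N"
  shows "complete_hypergraph l N"
  unfolding complete_hypergraph_def
proof safe
  obtain g where g: "is_iso g N M"
    using assms(4) isomorphic_sym by (auto simp: isomorphic_def)
  fix xs assume xs: "set xs \<subseteq> verts N" "l = length xs" "distinct xs"
  then have "set (map g xs) \<subseteq> verts M" "length (map g xs) = l" "distinct (map g xs)"
    using g by (auto simp: is_iso_def bij_betw_def distinct_map intro: inj_on_subset)
  then have "map g xs \<in> rels M ()"
    using M(2) unfolding complete_hypergraph_def by blast
  then show "xs \<in> rels N ()"
    using g xs by (auto simp: is_iso_def)
qed

lemma complete_hypergraph_Aut: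
  assumes "M \<in> models (hypergraph_theory l)" "complete_hypergraph l M"
  shows "Aut M = {f. f permutes verts M}"
  using complete_hypergraph_is_iso[OF assms assms] by (auto simp: Aut_def permutes_imp_bij)

lemma UInduce_lin_order:
  assumes "\<psi> \<in> limit_objects lin_order_theory"
  shows "UInduce l lin_order_theory \<psi>"
  unfolding UInduce_def
proof (intro disjI2 ballI impI)
  let ?H = "hypergraph_theory l"
  let ?S = "lin_order_theory \<uplus>\<^sub>T ?H"
  fix \<psi>' \<xi> M
  assume \<xi>: "\<xi> \<in> couplings lin_order_theory ?H \<psi> \<psi>'" and M: "M \<in> finite_models ?S"
    and complete: "complete_hypergraph l (right_reduct M)"
  have left: "left_reduct K \<in> finite_models lin_order_theory"
    and right: "right_reduct K \<in> finite_models ?H" if "K \<in> finite_models ?S" for K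
    using that by (simp_all add: finite_models_disj_union_iff)
  note rm = finite_models_models[OF right]
  \<comment> \<open>Isomorphic right reducts have equal size, so an order isomorphism
    \<open>f\<close> exists; both hypergraphs are complete, so \<open>f\<close> respects the
    hyperedges as well.\<close>
  have iso: "isomorphic M K \<longleftrightarrow> isomorphic (right_reduct M) (right_reduct K)"
    if K: "K \<in> finite_models ?S" for K
  proof
    assume R: "isomorphic (right_reduct M) (right_reduct K)"
    then obtain f where f: "is_iso f (left_reduct M) (left_reduct K)"
      using lin_order_iso_exists[OF left[OF M] left[OF K]] isomorphic_card by fastforce
    have "is_iso f (right_reduct M) (right_reduct K)"
      using f isomorphic_complete_hypergraph[OF rm[OF M] complete rm[OF K] R]
      by (intro complete_hypergraph_is_iso[OF rm[OF M] complete rm[OF K]]) (simp_all add: is_iso_def)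
    with f show "isomorphic M K"
      by (auto simp: isomorphic_def is_iso_disj_union_iff)
  qed (rule isomorphic_reduct)
  \<comment> \<open>The class of \<open>M\<close> is the only one above the class of its hypergraph
    reduct, so the right marginal collapses to a single value of \<xi>.\<close>
  have "{D \<in> iso_classes ?S. right_reduct ` D \<subseteq> iso_class ?H (right_reduct M)} = {iso_class ?S M}"
    (is "?I = _")
  proof (intro equalityI subsetI)
    fix D assume D: "D \<in> ?I"
    then obtain K where K: "K \<in> finite_models ?S" "D = iso_class ?S K"
      by (auto elim: iso_classesE)
    then have "right_reduct K \<in> iso_class ?H (right_reduct M)"
      using D iso_class_self by auto
    then show "D \<in> {iso_class ?S M}"
      using iso[OF K(1)] iso_class_eqI[OF M K(1)] K(2) in_iso_class_iff[OF right[OF M]] by simp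
  qed (auto simp: M iso_class_in_classes in_iso_class_iff right isomorphic_reduct)
  then have "\<psi>' (iso_class ?H (right_reduct M)) = \<xi> (iso_class ?S M)"
    using \<xi> by (auto simp: couplings_def right_marginal_def iso_class_in_classes right M)
  moreover define K where "K = (SOME K. K \<in> iso_class ?S M)"
  have K: "K \<in> finite_models ?S" "iso_class ?S K = iso_class ?S M"
    unfolding K_def by (intro some_in_iso_class iso_class_in_classes M)+
  then have MK: "isomorphic M K"
    using iso_class_eqD M by metis
  have "complete_hypergraph l (right_reduct K)"
    using isomorphic_complete_hypergraph[OF rm[OF M] complete rm[OF K(1)]] isomorphic_reduct MK
    by blast
  then have "card (Aut (right_reduct K)) = fact (card (verts K))"
    using complete_hypergraph_Aut[OF rm[OF K(1)]] finite_models_finite[OF K(1)]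
    by (simp add: card_permutations)
  moreover have "card (Aut K) = 1" "card (Aut (left_reduct K)) = 1"
  proof -
    have "Aut K = {id}"
      using lin_order_Aut[OF left[OF K(1)]]
      by (auto simp: Aut_def is_iso_disj_union_iff is_iso_id permutes_id)
    then show "card (Aut K) = 1" "card (Aut (left_reduct K)) = 1"
      by (simp_all add: lin_order_Aut[OF left[OF K(1)]])
  qed
  moreover have "iso_class ?H (right_reduct K) = iso_class ?H (right_reduct M)"
    using iso_class_eqI[OF right[OF M] right[OF K(1)]] isomorphic_reduct MK by metis
  moreover have "\<psi> (iso_class lin_order_theory (left_reduct K)) = 1"
    using assms by (simp add: limit_objects_lin_order iso_class_in_classes left K)
  \<comment> \<open>With n vertices the independent value is n!/1 * (1/n! * 1) * (n!/n! * \<psi>'),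
    where \<psi>' is taken at the hypergraph reduct; all factorials cancel.\<close>
  ultimately show "\<xi> (iso_class ?S M) = indep_coupling lin_order_theory ?H \<psi> \<psi>' (iso_class ?S M)"
    by (simp add: indep_coupling_def Let_def labelled_def iso_class_in_classes M flip: K_def)
qed

section \<open>Colourings\<close>

text \<open>The symbol is a natural number because \<open>UCouple\<close> quantifies over theories
  with such symbols. For a unary symbol the set of canonical axioms is empty.\<close>

definition colour_theory :: "nat univ_theory" where
  "colour_theory = \<lparr>syms = {0}, ar = \<lambda>_. 1, axs = {}\<rparr>"

definition red :: "nat rel_struct \<Rightarrow> nat set" where
  "red M = {x. [x] \<in> rels M 0}"

definition colouring :: "nat set \<Rightarrow> nat set \<Rightarrow> nat rel_struct" where
  "colouring V X = \<lparr>verts = V, rels = \<lambda>P. if P = 0 then {[x] | x. x \<in> X} else {}\<rparr>"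

lemma canonical_colour_theory: "canonical_theory colour_theory"
  by (simp add: canonical_theory_def colour_theory_def canonical_axs_def)

lemma verts_colouring [simp]: "verts (colouring V X) = V"
  and red_colouring [simp]: "red (colouring V X) = X"
  by (auto simp: colouring_def red_def)

lemma colouring_model: "X \<subseteq> V \<Longrightarrow> colouring V X \<in> models colour_theory"
  by (auto simp: colouring_def models_def colour_theory_def)

lemma red_induced: "red (induced M U) = red M \<inter> U"
  by (auto simp: red_def induced_def)

lemma red_subset: "M \<in> models colour_theory \<Longrightarrow> red M \<subseteq> verts M"
  using models_rels_verts by (fastforce simp: red_def)

lemma colour_rels:
  assumes "M \<in> models colour_theory"
  shows "rels M P = (if P = 0 then {[x] | x. x \<in> red M} else {})"
proof -
  have "length xs = 1" if "xs \<in> rels M 0" for xs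
    using assms that by (auto simp: models_def colour_theory_def)
  then have "rels M 0 = {[x] | x. x \<in> red M}"
    by (fastforce simp: red_def length_Suc_conv)
  moreover have "rels M P = {}" if "P \<noteq> 0"
    using assms that by (simp add: models_def colour_theory_def)
  ultimately show ?thesis by simp
qed

lemma colour_is_iso_iff:
  assumes M: "M \<in> models colour_theory" and N: "N \<in> models colour_theory"
  shows "is_iso f M N \<longleftrightarrow>
    bij_betw f (verts M) (verts N) \<and> (\<forall>x\<in>verts M. x \<in> red M \<longleftrightarrow> f x \<in> red N)"
proof safe
  assume f: "is_iso f M N"
  then show "bij_betw f (verts M) (verts N)"
    by (simp add: is_iso_def)
  have "[x] \<in> rels M 0 \<longleftrightarrow> map f [x] \<in> rels N 0" if "x \<in> verts M" for x
    using f that unfolding is_iso_def by (metis empty_set empty_subsetI insert_subset list.simps(15))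
  then have "x \<in> red M \<longleftrightarrow> f x \<in> red N" if "x \<in> verts M" for x
    using that by (simp add: red_def)
  then show "f x \<in> red N" if "x \<in> verts M" "x \<in> red M" for x
    using that by simp
  show "x \<in> red M" if "x \<in> verts M" "f x \<in> red N" for x
    using that \<open>\<And>x. x \<in> verts M \<Longrightarrow> x \<in> red M \<longleftrightarrow> f x \<in> red N\<close> by simp
next
  assume "bij_betw f (verts M) (verts N)" "\<forall>x\<in>verts M. x \<in> red M \<longleftrightarrow> f x \<in> red N"
  then show "is_iso f M N"
    by (auto simp: is_iso_def colour_rels[OF M] colour_rels[OF N] map_eq_Cons_conv)
qed

text \<open>The numbers of vertices and of red vertices form a complete invariant: a bijection of
  the red parts and one of the blue parts glue to an isomorphism.\<close>

lemma colour_isomorphic_iff: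
  assumes M: "M \<in> finite_models colour_theory" and N: "N \<in> finite_models colour_theory"
  shows "isomorphic M N \<longleftrightarrow>
    card (verts M) = card (verts N) \<and> card (red M) = card (red N)"
proof
  note [simp] = colour_is_iso_iff[OF finite_models_models[OF M] finite_models_models[OF N]]
  note sub = red_subset[OF finite_models_models[OF M]] red_subset[OF finite_models_models[OF N]]
  note fin = finite_models_finite[OF M] finite_models_finite[OF N]
  have finr: "finite (red M)" "finite (red N)"
    using sub fin finite_subset by blast+
  {
    assume "isomorphic M N"
    then obtain f where f: "bij_betw f (verts M) (verts N)"
      "\<forall>x\<in>verts M. x \<in> red M \<longleftrightarrow> f x \<in> red N"
      by (auto simp: isomorphic_def)
    then have "f ` red M = red N"
      using sub by (fastforce simp: bij_betw_def)
    then have "bij_betw f (red M) (red N)"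
      using bij_betw_subset[OF f(1) sub(1)] by simp
    then show "card (verts M) = card (verts N) \<and> card (red M) = card (red N)"
      using f(1) by (simp add: bij_betw_same_card)
  next
    assume c: "card (verts M) = card (verts N) \<and> card (red M) = card (red N)"
    then obtain g where g: "bij_betw g (red M) (red N)"
      using finr finite_same_card_bij by blast
    have "card (verts M - red M) = card (verts N - red N)"
      using c sub finr by (simp add: card_Diff_subset)
    then obtain h where h: "bij_betw h (verts M - red M) (verts N - red N)"
      using finite_same_card_bij[OF finite_Diff[OF fin(1)] finite_Diff[OF fin(2)]] by blast
    let ?f = "\<lambda>x. if x \<in> red M then g x else h x"
    have "bij_betw ?f (red M \<union> (verts M - red M)) (red N \<union> (verts N - red N))"
      using g h by (rule bij_betw_disjoint_Un) auto
    moreover have "red M \<union> (verts M - red M) = verts M" "red N \<union> (verts N - red N) = verts N"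
      using sub by auto
    moreover have "x \<in> red M \<longleftrightarrow> ?f x \<in> red N" if "x \<in> verts M" for x
      using that g h by (auto simp: bij_betw_def)
    ultimately have "is_iso ?f M N" by simp
    then show "isomorphic M N"
      unfolding isomorphic_def by blast
  }
qed

section \<open>Sampling without replacement and its binomial limit\<close>

lemma card_subsets_Int:
  assumes "finite V" "X \<subseteq> V" "j \<le> m"
  shows "card {U. U \<subseteq> V \<and> card U = m \<and> card (U \<inter> X) = j} =
    (card X choose j) * ((card V - card X) choose (m - j))"
proof -
  let ?A = "{A. A \<subseteq> X \<and> card A = j}" and ?B = "{B. B \<subseteq> V - X \<and> card B = m - j}"
  have fin: "finite X" "finite (V - X)"
    using assms finite_subset by auto
  \<comment> \<open>Split \<open>U\<close> into its parts inside and outside \<open>X\<close>. The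
    bound j \<le> m guards the truncated subtraction m - j.\<close>
  have "bij_betw (\<lambda>(A, B). A \<union> B) (?A \<times> ?B) {U. U \<subseteq> V \<and> card U = m \<and> card (U \<inter> X) = j}"
  proof (rule bij_betw_byWitness[where f' = "\<lambda>U. (U \<inter> X, U - X)"])
    show "(\<lambda>(A, B). A \<union> B) ` (?A \<times> ?B) \<subseteq> {U. U \<subseteq> V \<and> card U = m \<and> card (U \<inter> X) = j}"
    proof clarsimp
      fix A B assume AB: "A \<subseteq> X" "B \<subseteq> V - X" "card B = m - card A" "j = card A"
      then have "card (A \<union> B) = card A + card B"
        using fin by (intro card_Un_disjoint) (auto intro: finite_subset)
      moreover have "(A \<union> B) \<inter> X = A"
        using AB by auto
      ultimately show "A \<subseteq> V \<and> B \<subseteq> V \<and> card (A \<union> B) = m \<and> card ((A \<union> B) \<inter> X) = card A"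
        using AB assms by auto
    qed
    show "(\<lambda>U. (U \<inter> X, U - X)) ` {U. U \<subseteq> V \<and> card U = m \<and> card (U \<inter> X) = j} \<subseteq> ?A \<times> ?B"
      using assms(1) by (auto simp: card_Diff_subset_Int finite_subset Int_commute)
  qed auto
  then have "card {U. U \<subseteq> V \<and> card U = m \<and> card (U \<inter> X) = j} = card ?A * card ?B"
    by (simp add: bij_betw_same_card card_cartesian_product flip: bij_betw_same_card)
  then show ?thesis
    using fin assms by (simp add: n_subsets card_Diff_subset)
qed

lemma density_colour:
  assumes M: "M \<in> finite_models colour_theory" and N: "N \<in> finite_models colour_theory"
  shows "density M N = real (card (red N) choose card (red M)) *
    real ((card (verts N) - card (red N)) choose (card (verts M) - card (red M))) /
    real (card (verts N) choose card (verts M))"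
proof -
  note M' = finite_models_models[OF M] and N' = finite_models_models[OF N]
  have "{U. U \<subseteq> verts N \<and> card U = card (verts M) \<and> isomorphic M (induced N U)} =
    {U. U \<subseteq> verts N \<and> card U = card (verts M) \<and> card (U \<inter> red N) = card (red M)}"
    using colour_isomorphic_iff[OF M induced_in_finite_models[OF N]]
    by (auto simp: red_induced Int_commute)
  moreover have "card (red M) \<le> card (verts M)"
    using red_subset[OF M'] finite_models_finite[OF M] by (rule card_mono[rotated])
  ultimately show ?thesis
    by (simp add: density_def card_subsets_Int[OF finite_models_finite[OF N] red_subset[OF N']])
qed

text \<open>Up to k!, the quotient is a product of k factors (a n - i) / n, and each of them tends
  to \<open>c\<close>.\<close>

lemma binomial_over_power_limit:
  fixes a :: "nat \<Rightarrow> nat"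
  assumes "(\<lambda>n. real (a n) / real n) \<longlonglongrightarrow> c"
  shows "(\<lambda>n. real (a n choose k) / real n ^ k) \<longlonglongrightarrow> c ^ k / fact k"
proof -
  have "(\<lambda>n. real (a n) / real n - real i * (1 / real n)) \<longlonglongrightarrow> c - real i * 0" for i
    by (intro tendsto_intros assms lim_1_over_n)
  then have "(\<lambda>n. (\<Prod>i<k. real (a n) / real n - real i * (1 / real n)) / fact k) \<longlonglongrightarrow>
      (\<Prod>i<k. c) / fact k"
    by (intro tendsto_intros) simp_all
  \<comment> \<open>This holds at n = 0 too: division by 0 yields 0, so both sides vanish there
    unless k = 0, when both are 1.\<close>
  moreover have "real (a n choose k) / real n ^ k =
      (\<Prod>i<k. real (a n) / real n - real i * (1 / real n)) / fact k" for n
    by (simp add: binomial_gbinomial gbinomial_prod_rev atLeast0LessThan prod_dividef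
        flip: diff_divide_distrib)
  ultimately show ?thesis by simp
qed

text \<open>Divide each binomial coefficient by its power of \<open>n\<close>; since m = j + (m - j)
  the powers cancel, and the three limits combine to the binomial distribution.\<close>

lemma hypergeometric_limit:
  fixes a :: "nat \<Rightarrow> nat"
  assumes lim: "(\<lambda>n. real (a n) / real n) \<longlonglongrightarrow> p" and le: "\<And>n. a n \<le> n" and "j \<le> m"
  shows "(\<lambda>n. real (a n choose j) * real ((n - a n) choose (m - j)) / real (n choose m))
    \<longlonglongrightarrow> real (m choose j) * p ^ j * (1 - p) ^ (m - j)"
proof -
  have one: "(\<lambda>n. real n / real n) \<longlonglongrightarrow> 1"
    by (rule tendsto_eventually, rule eventually_mono[OF eventually_gt_at_top[of 0]]) simp
  have "(\<lambda>n. real n / real n - real (a n) / real n) \<longlonglongrightarrow> 1 - p"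
    by (intro tendsto_intros one lim)
  then have lim': "(\<lambda>n. real (n - a n) / real n) \<longlonglongrightarrow> 1 - p"
    using le by (simp add: of_nat_diff diff_divide_distrib)
  have "(\<lambda>n. (real (a n choose j) / real n ^ j) *
        (real ((n - a n) choose (m - j)) / real n ^ (m - j)) / (real (n choose m) / real n ^ m))
      \<longlonglongrightarrow> (p ^ j / fact j) * ((1 - p) ^ (m - j) / fact (m - j)) / (1 ^ m / fact m)"
    by (intro tendsto_intros binomial_over_power_limit lim lim' one) simp
  moreover have "\<forall>\<^sub>F n in sequentially. (real (a n choose j) / real n ^ j) *
        (real ((n - a n) choose (m - j)) / real n ^ (m - j)) / (real (n choose m) / real n ^ m) =
        real (a n choose j) * real ((n - a n) choose (m - j)) / real (n choose m)"
  proof (rule eventually_mono[OF eventually_gt_at_top[of 0]])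
    fix n :: nat assume "0 < n"
    moreover have "real n ^ m = real n ^ j * real n ^ (m - j)"
      using \<open>j \<le> m\<close> by (simp flip: power_add)
    ultimately show "(real (a n choose j) / real n ^ j) *
        (real ((n - a n) choose (m - j)) / real n ^ (m - j)) / (real (n choose m) / real n ^ m) =
        real (a n choose j) * real ((n - a n) choose (m - j)) / real (n choose m)"
      by simp
  qed
  ultimately have "(\<lambda>n. real (a n choose j) * real ((n - a n) choose (m - j)) / real (n choose m))
      \<longlonglongrightarrow> (p ^ j / fact j) * ((1 - p) ^ (m - j) / fact (m - j)) / (1 ^ m / fact m)"
    by (rule Lim_transform_eventually)
  moreover have "(p ^ j / fact j) * ((1 - p) ^ (m - j) / fact (m - j)) / (1 ^ m / fact m) =
      real (m choose j) * p ^ j * (1 - p) ^ (m - j)"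
    using \<open>j \<le> m\<close> by (simp add: binomial_fact)
  ultimately show ?thesis by simp
qed

lemma floor_ratio_limit:
  assumes "0 \<le> p"
  shows "(\<lambda>n. real (nat \<lfloor>p * real n\<rfloor>) / real n) \<longlonglongrightarrow> p"
proof (rule tendsto_sandwich)
  have "(\<lambda>n. p - 1 / real n) \<longlonglongrightarrow> p - 0"
    by (intro tendsto_intros lim_1_over_n)
  then show "(\<lambda>n. p - 1 / real n) \<longlonglongrightarrow> p" by simp
  have r: "real (nat \<lfloor>p * real n\<rfloor>) \<le> p * real n" "p * real n - 1 \<le> real (nat \<lfloor>p * real n\<rfloor>)" for n
    using assms by (simp_all add: of_nat_nat)
  show "\<forall>\<^sub>F n in sequentially. p - 1 / real n \<le> real (nat \<lfloor>p * real n\<rfloor>) / real n"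
  proof (rule eventually_mono[OF eventually_gt_at_top[of 0]])
    fix n :: nat assume "0 < n"
    then show "p - 1 / real n \<le> real (nat \<lfloor>p * real n\<rfloor>) / real n"
      using divide_right_mono[OF r(2)[of n], of "real n"] by (simp add: diff_divide_distrib)
  qed
  show "\<forall>\<^sub>F n in sequentially. real (nat \<lfloor>p * real n\<rfloor>) / real n \<le> p"
    by (rule eventually_mono[OF eventually_gt_at_top[of 0]]) (use r(1) in \<open>simp add: field_simps\<close>)
qed simp

section \<open>The colouring as a theon of rank one\<close>

text \<open>The only nonempty subset of \<open>{..<1}\<close> is \<open>{0}\<close>, so a point of
  the peon is a single coordinate: a vertex is red when the coordinate of its singleton lies in
  \<open>A\<close>.\<close>

definition colour_theon :: "'x measure \<Rightarrow> 'x set \<Rightarrow> nat \<Rightarrow> (nat set \<Rightarrow> 'x) set" where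
  "colour_theon \<Omega> A P = {x \<in> PiE (fin_nonempty {..<1}) (\<lambda>_. space \<Omega>). x {0} \<in> A}"

context
  fixes \<Omega> :: "'x measure" and A :: "'x set"
  assumes prob: "prob_space \<Omega>" and A: "A \<in> sets \<Omega>"
begin

lemma theon_struct_colour:
  assumes "\<theta> \<in> space (theon_space UNIV \<Omega>)"
  shows "theon_struct colour_theory (colour_theon \<Omega> A) \<theta> = colouring UNIV {i. \<theta> {i} \<in> A}"
proof -
  have \<theta>: "\<theta> B \<in> space \<Omega>" if "finite B" "B \<noteq> {}" for B
    using assms that by (auto simp: theon_space_def space_PiM fin_nonempty_def)
  have "pull [i] \<theta> \<in> colour_theon \<Omega> A P \<longleftrightarrow> \<theta> {i} \<in> A" for i P
    using \<theta> by (auto simp: pull_def colour_theon_def fin_nonempty_def finite_subset)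
  then show ?thesis
    by (auto simp: theon_struct_def colouring_def colour_theory_def fun_eq_iff length_Suc_conv)
qed

lemma is_theon_colour: "is_theon \<Omega> colour_theory (colour_theon \<Omega> A)"
  unfolding is_theon_def
proof
  let ?P = "PiM (fin_nonempty {..<1}) (\<lambda>_. \<Omega>)"
  have "{0} \<in> fin_nonempty {..<1}"
    by (simp add: fin_nonempty_def)
  then have "{x \<in> space ?P. x {0} \<in> A} \<in> sets ?P"
    using A by measurable
  then have "colour_theon \<Omega> A P \<in> sets ?P" for P
    by (simp add: colour_theon_def space_PiM)
  then show "\<forall>P\<in>syms colour_theory.
      colour_theon \<Omega> A P \<in> sets (theon_space {..<ar colour_theory P} \<Omega>)"
    by (simp add: colour_theory_def theon_space_def)
  show "AE \<theta> in theon_space UNIV \<Omega>.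
      theon_struct colour_theory (colour_theon \<Omega> A) \<theta> \<in> models colour_theory"
    by (rule AE_I2) (simp add: theon_struct_colour colouring_model)
qed

text \<open>Nonempty subsets of \<open>{..<1}\<close> have one element, so restricting to
  coordinates of size at most 1 discards nothing and the peon itself serves as the base set.\<close>

lemma colour_theon_rank: "peon_rank_le \<Omega> 1 (colour_theon \<Omega> A P) 1"
proof -
  have I: "{B \<in> fin_nonempty {..<1::nat}. card B \<le> 1} = fin_nonempty {..<1}"
    using card_mono[of "{..<1::nat}"] by (auto simp: fin_nonempty_def)
  have sub: "colour_theon \<Omega> A P \<subseteq> PiE (fin_nonempty {..<1}) (\<lambda>_. space \<Omega>)"
    by (auto simp: colour_theon_def)
  have eq: "{x \<in> PiE (fin_nonempty {..<1}) (\<lambda>_. space \<Omega>).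
      restrict x (fin_nonempty {..<1}) \<in> colour_theon \<Omega> A P} = colour_theon \<Omega> A P"
  proof -
    have "restrict x (fin_nonempty {..<1}) \<in> colour_theon \<Omega> A P \<longleftrightarrow> x {0} \<in> A"
      if "x \<in> PiE (fin_nonempty {..<1}) (\<lambda>_. space \<Omega>)" for x
      using that unfolding colour_theon_def PiE_restrict[OF that] by simp
    then have "{x \<in> PiE (fin_nonempty {..<1}) (\<lambda>_. space \<Omega>).
        restrict x (fin_nonempty {..<1}) \<in> colour_theon \<Omega> A P} =
        {x \<in> PiE (fin_nonempty {..<1}) (\<lambda>_. space \<Omega>). x {0} \<in> A}"
      by (rule Collect_cong[OF conj_cong[OF refl]])
    then show ?thesis
      by (rule trans) (simp add: colour_theon_def)
  qed
  show ?thesis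
    unfolding peon_rank_le_def I by (rule exI[of _ "colour_theon \<Omega> A P"], rule conjI[OF sub eq[symmetric]])
qed

text \<open>Prescribing the colours of the first \<open>m\<close> vertices is a cylinder over
  \<open>m\<close> distinct singleton coordinates, and these are independent.\<close>

lemma measure_theon_colour_pattern:
  assumes "J \<subseteq> {..<m}"
  defines "E \<equiv> {\<theta> \<in> space (PiM (fin_nonempty UNIV) (\<lambda>_. \<Omega>)). \<forall>i<m. \<theta> {i} \<in> A \<longleftrightarrow> i \<in> J}"
  shows "E \<in> sets (PiM (fin_nonempty UNIV) (\<lambda>_. \<Omega>))"
    and "measure (PiM (fin_nonempty UNIV) (\<lambda>_. \<Omega>)) E =
      measure \<Omega> A ^ card J * (1 - measure \<Omega> A) ^ (m - card J)"
proof -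
  interpret prob_space \<Omega> by (rule prob)
  interpret P: product_prob_space "\<lambda>_::nat set. \<Omega>" "fin_nonempty UNIV"
    by standard
  \<comment> \<open>Coordinates are indexed by sets; \<open>the_elem\<close> recovers the vertex
    from its singleton.\<close>
  define X where "X S = (if the_elem S \<in> J then A else space \<Omega> - A)" for S
  let ?I = "(\<lambda>i::nat. {i}) ` {..<m}"
  have I: "?I \<subseteq> fin_nonempty UNIV"
    by (auto simp: fin_nonempty_def)
  have X: "X S \<in> sets \<Omega>" for S
    using A by (simp add: X_def)
  have E: "E = prod_emb (fin_nonempty UNIV) (\<lambda>_. \<Omega>) ?I (PiE ?I X)"
  proof (intro set_eqI)
    fix \<theta>
    have "\<theta> {i} \<in> X {i} \<longleftrightarrow> (\<theta> {i} \<in> A \<longleftrightarrow> i \<in> J)" if "\<theta> {i} \<in> space \<Omega>" for i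
      using that by (simp add: X_def)
    moreover have "\<theta> {i} \<in> space \<Omega>" if "\<theta> \<in> space (PiM (fin_nonempty UNIV) (\<lambda>_. \<Omega>))" for i
      using PiE_mem[of \<theta> "fin_nonempty UNIV" "\<lambda>_. space \<Omega>" "{i}"] that
      by (simp add: space_PiM fin_nonempty_def)
    ultimately show "\<theta> \<in> E \<longleftrightarrow> \<theta> \<in> prod_emb (fin_nonempty UNIV) (\<lambda>_. \<Omega>) ?I (PiE ?I X)"
      by (auto simp: E_def prod_emb_def space_PiM)
  qed
  show "E \<in> sets (PiM (fin_nonempty UNIV) (\<lambda>_. \<Omega>))"
    unfolding E using I X by (intro sets_PiM_I) auto
  have "measure (PiM (fin_nonempty UNIV) (\<lambda>_. \<Omega>)) E = (\<Prod>S\<in>?I. measure \<Omega> (X S))"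
    unfolding E using I X by (intro P.measure_PiM_emb) auto
  also have "\<dots> = (\<Prod>i<m. if i \<in> J then measure \<Omega> A else 1 - measure \<Omega> A)"
    using A by (subst prod.reindex) (auto simp: X_def prob_compl intro!: prod.cong)
  also have "\<dots> = measure \<Omega> A ^ card J * (1 - measure \<Omega> A) ^ (m - card J)"
    using assms(1) by (simp add: prod.If_cases Int_absorb1 card_Diff_subset finite_subset
        flip: Diff_eq)
  finally show "measure (PiM (fin_nonempty UNIV) (\<lambda>_. \<Omega>)) E =
      measure \<Omega> A ^ card J * (1 - measure \<Omega> A) ^ (m - card J)" .
qed

text \<open>The event splits according to the red set \<open>J\<close> within the first
  \<open>m\<close> vertices, and all patterns with the same number of red vertices have equal
  probability.\<close>

lemma theon_limit_colour:
  assumes M: "M \<in> finite_models colour_theory"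
  shows "theon_limit \<Omega> colour_theory (colour_theon \<Omega> A) (iso_class colour_theory M) =
    real (card (verts M) choose card (red M)) * measure \<Omega> A ^ card (red M) *
      (1 - measure \<Omega> A) ^ (card (verts M) - card (red M))"
proof -
  let ?P = "PiM (fin_nonempty UNIV) (\<lambda>_. \<Omega>)"
  define m j where "m = card (verts M)" and "j = card (red M)"
  define E where "E J = {\<theta> \<in> space ?P. \<forall>i<m. \<theta> {i} \<in> A \<longleftrightarrow> i \<in> J}" for J
  let ?J = "{J. J \<subseteq> {..<m} \<and> card J = j}"
  interpret P: prob_space ?P
    by (intro prob_space_PiM prob)
  \<comment> \<open>Members of the class share the size of \<open>M\<close> and are isomorphic to
    it, so \<open>K\<close> can be replaced by \<open>M\<close>; only the number of red vertices
    below \<open>m\<close> matters.\<close>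
  have "(\<exists>K\<in>iso_class colour_theory M. isomorphic K
      (induced (theon_struct colour_theory (colour_theon \<Omega> A) \<theta>) {..<card (verts K)})) \<longleftrightarrow>
    card ({i. \<theta> {i} \<in> A} \<inter> {..<m}) = j" (is "?L \<longleftrightarrow> ?R")
    if \<theta>: "\<theta> \<in> space (theon_space UNIV \<Omega>)" for \<theta>
  proof -
    let ?N = "induced (colouring UNIV {i. \<theta> {i} \<in> A}) {..<m}"
    have N: "?N \<in> finite_models colour_theory"
      by (simp add: finite_models_def induced_in_models colouring_model)
    have "?L \<longleftrightarrow> (\<exists>K\<in>iso_class colour_theory M. isomorphic K ?N)"
      using M by (intro bex_cong refl)
        (auto simp: theon_struct_colour[OF \<theta>] in_iso_class_iff m_def dest: isomorphic_card)
    also have "\<dots> \<longleftrightarrow> isomorphic M ?N"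
      using in_iso_class_iff[OF M] iso_class_self[OF M] isomorphic_trans by blast
    also have "\<dots> \<longleftrightarrow> ?R"
      unfolding colour_isomorphic_iff[OF M N] by (auto simp: red_induced m_def j_def)
    finally show ?thesis .
  qed
  then have "{\<theta> \<in> space (theon_space UNIV \<Omega>). \<exists>K\<in>iso_class colour_theory M. isomorphic K
      (induced (theon_struct colour_theory (colour_theon \<Omega> A) \<theta>) {..<card (verts K)})} =
    {\<theta> \<in> space (theon_space UNIV \<Omega>). card ({i. \<theta> {i} \<in> A} \<inter> {..<m}) = j}"
    by blast
  also have "\<dots> = (\<Union>J\<in>?J. E J)"
  proof (intro equalityI subsetI)
    fix \<theta> assume "\<theta> \<in> {\<theta> \<in> space (theon_space UNIV \<Omega>). card ({i. \<theta> {i} \<in> A} \<inter> {..<m}) = j}"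
    then show "\<theta> \<in> (\<Union>J\<in>?J. E J)"
      by (intro UN_I[of "{i. \<theta> {i} \<in> A} \<inter> {..<m}"]) (auto simp: E_def theon_space_def)
  next
    fix \<theta> assume "\<theta> \<in> (\<Union>J\<in>?J. E J)"
    then obtain J where J: "J \<subseteq> {..<m}" "card J = j" "\<theta> \<in> E J"
      by blast
    then have "{i. \<theta> {i} \<in> A} \<inter> {..<m} = J"
      by (auto simp: E_def)
    with J show "\<theta> \<in> {\<theta> \<in> space (theon_space UNIV \<Omega>). card ({i. \<theta> {i} \<in> A} \<inter> {..<m}) = j}"
      by (auto simp: E_def theon_space_def)
  qed
  finally have "theon_limit \<Omega> colour_theory (colour_theon \<Omega> A) (iso_class colour_theory M) =
      measure (theon_space UNIV \<Omega>) (\<Union>J\<in>?J. E J)"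
    using M by (simp add: theon_limit_def iso_class_in_classes)
  \<comment> \<open>A finite union of measurable cylinders keeps its measure under
    completion.\<close>
  also have "\<dots> = measure ?P (\<Union>J\<in>?J. E J)"
    unfolding theon_space_def
    by (intro measure_completion sets.finite_UN) (auto simp: E_def measure_theon_colour_pattern(1))
  also have "\<dots> = (\<Sum>J\<in>?J. measure ?P (E J))"
  proof (rule P.finite_measure_finite_Union)
    show "disjoint_family_on E ?J"
      unfolding disjoint_family_on_def
    proof (intro ballI impI)
      fix J K assume "J \<in> ?J" "K \<in> ?J" "J \<noteq> K"
      then obtain i where "i < m" "i \<in> J \<longleftrightarrow> i \<notin> K"
        by blast
      then show "E J \<inter> E K = {}"
        by (auto simp: E_def)
    qed
  qed (auto simp: E_def measure_theon_colour_pattern(1))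
  also have "\<dots> = (\<Sum>J\<in>?J. measure \<Omega> A ^ j * (1 - measure \<Omega> A) ^ (m - j))"
    by (intro sum.cong) (auto simp: E_def measure_theon_colour_pattern(2))
  finally show ?thesis
    by (simp add: n_subsets m_def j_def)
qed

end

section \<open>A dependent coupling\<close>

definition coloured_order :: "nat \<Rightarrow> nat set \<Rightarrow> (unit + nat) rel_struct" where
  "coloured_order n X =
     \<lparr>verts = {..<n}, rels = case_sum (rels (nat_order n)) (rels (colouring {..<n} X))\<rparr>"

abbreviation coloured_orders :: "(unit + nat) univ_theory" where
  "coloured_orders \<equiv> lin_order_theory \<uplus>\<^sub>T colour_theory"

lemma reduct_coloured_order [simp]:
  "left_reduct (coloured_order n X) = nat_order n"
  "right_reduct (coloured_order n X) = colouring {..<n} X"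
  by (simp_all add: left_reduct_def right_reduct_def coloured_order_def nat_order_def colouring_def)

lemma coloured_order_model:
  "X \<subseteq> {..<n} \<Longrightarrow> coloured_order n X \<in> finite_models coloured_orders"
  by (simp add: finite_models_disj_union_iff nat_order_model)
    (simp add: finite_models_def colouring_model)

lemma verts_coloured_order [simp]: "verts (coloured_order n X) = {..<n}"
  by (simp add: coloured_order_def)

text \<open>The red vertices form an initial segment. This is invariant under isomorphism and
  inherited by induced substructures, so densities of types violating it vanish along the dependent
  sequence.\<close>

definition red_first :: "(unit + nat) rel_struct \<Rightarrow> bool" where
  "red_first K \<longleftrightarrow> (\<forall>x\<in>red (right_reduct K). \<forall>y\<in>verts K - red (right_reduct K).
     [x, y] \<in> rels (left_reduct K) ())"

lemma finite_models_left:
  "K \<in> finite_models (T \<uplus>\<^sub>T T') \<Longrightarrow> left_reduct K \<in> finite_models T"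
  and finite_models_right:
  "K \<in> finite_models (T \<uplus>\<^sub>T T') \<Longrightarrow> right_reduct K \<in> finite_models T'"
  by (simp_all add: finite_models_disj_union_iff)

lemma red_right_subset:
  "K \<in> finite_models coloured_orders \<Longrightarrow> red (right_reduct K) \<subseteq> verts K"
  using red_subset[OF finite_models_models[OF finite_models_right]] by simp

lemma red_first_isomorphic:
  assumes K: "K \<in> finite_models coloured_orders" and L: "L \<in> finite_models coloured_orders"
    and iso: "isomorphic K L" and red: "red_first L"
  shows "red_first K"
  unfolding red_first_def
proof (intro ballI)
  obtain f where f: "is_iso f (left_reduct K) (left_reduct L)"
      "is_iso f (right_reduct K) (right_reduct L)"
    using iso by (auto simp: isomorphic_def is_iso_disj_union_iff)
  have c: "bij_betw f (verts K) (verts L)"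
      "\<forall>x\<in>verts K. x \<in> red (right_reduct K) \<longleftrightarrow> f x \<in> red (right_reduct L)"
    using f(2) colour_is_iso_iff[OF finite_models_models[OF finite_models_right[OF K]]
        finite_models_models[OF finite_models_right[OF L]]] by simp_all
  fix x y assume xy: "x \<in> red (right_reduct K)" "y \<in> verts K - red (right_reduct K)"
  then have x: "x \<in> verts K"
    using red_right_subset[OF K] by blast
  then have "f x \<in> red (right_reduct L)" "f y \<in> verts L - red (right_reduct L)"
    using xy c by (auto simp: bij_betw_def)
  then have "[f x, f y] \<in> rels (left_reduct L) ()"
    using red unfolding red_first_def by blast
  moreover have "[x, y] \<in> rels (left_reduct K) () \<longleftrightarrow> map f [x, y] \<in> rels (left_reduct L) ()"
  proof -
    have "set [x, y] \<subseteq> verts (left_reduct K)"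
      using x xy by simp
    then show ?thesis
      using f(1) unfolding is_iso_def by blast
  qed
  ultimately show "[x, y] \<in> rels (left_reduct K) ()"
    by simp
qed

text \<open>In both structures the red set is the initial segment of the same size, so an order
  isomorphism, which preserves ranks, also preserves colours.\<close>

lemma red_first_isomorphicI:
  assumes K: "K \<in> finite_models coloured_orders" and L: "L \<in> finite_models coloured_orders"
    and red: "red_first K" "red_first L" and iso: "isomorphic (right_reduct K) (right_reduct L)"
  shows "isomorphic K L"
proof -
  note lK = finite_models_left[OF K] and lL = finite_models_left[OF L]
  note rK = finite_models_right[OF K] and rL = finite_models_right[OF L]
  have c: "card (verts K) = card (verts L)" "card (red (right_reduct K)) = card (red (right_reduct L))"
    using iso colour_isomorphic_iff[OF rK rL] by simp_all
  then obtain f where f: "is_iso f (left_reduct K) (left_reduct L)"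
    using lin_order_iso_exists[OF lK lL] by auto
  then have bij: "bij_betw f (verts K) (verts L)"
    by (simp add: is_iso_def)
  have "x \<in> red (right_reduct K) \<longleftrightarrow> f x \<in> red (right_reduct L)" if x: "x \<in> verts K" for x
  proof -
    have fx: "f x \<in> verts L"
      using bij x by (auto simp: bij_betw_def)
    have "x \<in> red (right_reduct K) \<longleftrightarrow>
        order_rank (left_reduct K) x < card (red (right_reduct K))"
      using red(1) x red_right_subset[OF K]
      by (intro initial_segment_rank[OF lK]) (simp_all add: red_first_def)
    also have "\<dots> \<longleftrightarrow> order_rank (left_reduct L) (f x) < card (red (right_reduct L))"
      using is_iso_rank[OF lK lL f] x c(2) by simp
    also have "\<dots> \<longleftrightarrow> f x \<in> red (right_reduct L)"
      using red(2) fx red_right_subset[OF L]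
      by (intro initial_segment_rank[OF lL, symmetric]) (simp_all add: red_first_def)
    finally show ?thesis .
  qed
  then have "is_iso f (right_reduct K) (right_reduct L)"
    using bij colour_is_iso_iff[OF finite_models_models[OF rK] finite_models_models[OF rL]] by simp
  with f show ?thesis
    by (auto simp: isomorphic_def is_iso_disj_union_iff)
qed

lemma red_first_induced: "red_first K \<Longrightarrow> U \<subseteq> verts K \<Longrightarrow> red_first (induced K U)"
  by (auto simp: red_first_def induced_reduct red_induced) (auto simp: induced_def)

lemma red_first_coloured_order: "k \<le> n \<Longrightarrow> red_first (coloured_order n {..<k})"
  by (auto simp: red_first_def nat_order_def simp del: rels_reduct)

text \<open>Inside a red-first structure the colour reduct of a subset already determines its type,
  and only red-first types occur.\<close>

lemma density_red_first:
  assumes K: "K \<in> finite_models coloured_orders" and L: "L \<in> finite_models coloured_orders"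
    and red: "red_first L"
  shows "density K L = (if red_first K then density (right_reduct K) (right_reduct L) else 0)"
proof -
  have "isomorphic K (induced L U) \<longleftrightarrow>
      red_first K \<and> isomorphic (right_reduct K) (induced (right_reduct L) U)"
    if "U \<subseteq> verts L" for U
    using red_first_isomorphic[OF K induced_in_finite_models[OF L that]]
      red_first_isomorphicI[OF K induced_in_finite_models[OF L that]]
      red_first_induced[OF red that] isomorphic_reduct(2)[of K "induced L U"]
    by (auto simp: induced_reduct)
  then have "{U. U \<subseteq> verts L \<and> card U = card (verts K) \<and> isomorphic K (induced L U)} =
      {U. U \<subseteq> verts L \<and> card U = card (verts K) \<and> red_first K \<and>
        isomorphic (right_reduct K) (induced (right_reduct L) U)}"
    by blast
  then show ?thesis
    by (simp add: density_def)
qed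

section \<open>Separating the dependent and the independent coupling\<close>

lemma finite_Aut:
  assumes "finite (verts M)"
  shows "finite (Aut M)" and "0 < card (Aut M)"
proof -
  show "finite (Aut M)"
    using finite_permutations[OF assms] by (rule finite_subset[rotated]) (auto simp: Aut_def)
  moreover have "id \<in> Aut M"
    by (simp add: Aut_def permutes_id is_iso_id)
  ultimately show "0 < card (Aut M)"
    by (auto simp: card_gt_0_iff)
qed

lemma indep_coupling_pos:
  assumes M: "M \<in> finite_models (T \<uplus>\<^sub>T T')"
    and "0 < \<phi> (iso_class T (left_reduct M))" "0 < \<psi> (iso_class T' (right_reduct M))"
  shows "0 < indep_coupling T T' \<phi> \<psi> (iso_class (T \<uplus>\<^sub>T T') M)"
proof -
  define K where "K = (SOME K. K \<in> iso_class (T \<uplus>\<^sub>T T') M)"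
  have K: "K \<in> finite_models (T \<uplus>\<^sub>T T')" "iso_class (T \<uplus>\<^sub>T T') K = iso_class (T \<uplus>\<^sub>T T') M"
    unfolding K_def by (intro some_in_iso_class iso_class_in_classes M)+
  then have "isomorphic M K"
    using iso_class_eqD M by metis
  then have "iso_class T (left_reduct K) = iso_class T (left_reduct M)"
    "iso_class T' (right_reduct K) = iso_class T' (right_reduct M)"
    using iso_class_eqI isomorphic_reduct finite_models_left finite_models_right M K(1) by metis+
  moreover have "finite (verts K)"
    using K(1) by (rule finite_models_finite)
  ultimately show ?thesis
    using assms finite_Aut(2)[of K] finite_Aut(2)[of "left_reduct K"]
      finite_Aut(2)[of "right_reduct K"]
    by (simp add: indep_coupling_def Let_def labelled_def iso_class_in_classes flip: K_def)
qed

lemma not_UCouple_lin_order: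
  assumes prob: "prob_space \<Omega>" and "atomless \<Omega>" and \<psi>: "\<psi> \<in> limit_objects lin_order_theory"
  shows "\<not> UCouple \<Omega> 1 lin_order_theory \<psi>"
proof -
  interpret prob_space \<Omega> by (rule prob)
  \<comment> \<open>Atomlessness is applied to the whole space, which has measure 1.\<close>
  obtain A where A: "A \<in> sets \<Omega>" and "0 < emeasure \<Omega> A" "emeasure \<Omega> A < emeasure \<Omega> (space \<Omega>)"
    using \<open>atomless \<Omega>\<close> emeasure_space_1 unfolding atomless_def by (metis sets.top zero_less_one)
  define p where "p = measure \<Omega> A"
  have p: "0 < p" "p < 1"
    using \<open>0 < emeasure \<Omega> A\<close> \<open>emeasure \<Omega> A < emeasure \<Omega> (space \<Omega>)\<close>
    by (simp_all add: p_def emeasure_eq_measure prob_space)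
  define \<psi>' where "\<psi>' = theon_limit \<Omega> colour_theory (colour_theon \<Omega> A)"
  \<comment> \<open>The number of red points among \<open>n\<close>: rounding down keeps it at most
    \<open>n\<close> while its proportion still tends to \<open>p\<close>.\<close>
  define a where "a n = nat \<lfloor>p * real n\<rfloor>" for n :: nat
  define N where "N n = coloured_order n {..<a n}" for n
  have "p * real n \<le> real n" for n
    using p by (simp add: mult_left_le_one_le)
  then have a: "a n \<le> n" for n
    by (simp add: a_def nat_le_iff floor_le_iff) (smt (verit))
  have N: "N n \<in> finite_models coloured_orders" for n
    by (simp add: N_def coloured_order_model a)
  have lim': "(\<lambda>n. density M (right_reduct (N n))) \<longlonglongrightarrow> \<psi>' (iso_class colour_theory M)"
    if M: "M \<in> finite_models colour_theory" for M
  proof -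
    have "(\<lambda>n. real (a n) / real n) \<longlonglongrightarrow> p"
      unfolding a_def using p by (intro floor_ratio_limit) simp
    moreover have "card (red M) \<le> card (verts M)"
      using red_subset[OF finite_models_models[OF M]] finite_models_finite[OF M]
      by (rule card_mono[rotated])
    moreover have "right_reduct (N n) \<in> finite_models colour_theory" for n
      by (rule finite_models_right[OF N])
    ultimately show ?thesis
      using hypergeometric_limit[of a p "card (red M)" "card (verts M)"] a
      by (simp add: density_colour M \<psi>'_def theon_limit_colour[OF prob A] N_def p_def)
  qed
  have mono: "strict_mono (\<lambda>n. card (verts (N n)))"
    by (simp add: N_def strict_mono_def)
  have \<psi>'_PiE: "\<psi>' \<in> iso_classes colour_theory \<rightarrow>\<^sub>E {0..1}"
  proof -
    interpret P: prob_space "theon_space UNIV \<Omega>"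
      unfolding theon_space_def by (intro prob_space.prob_space_completion prob_space_PiM prob)
    show ?thesis
      by (auto simp: \<psi>'_def theon_limit_def)
  qed
  have \<psi>': "\<psi>' \<in> limit_objects colour_theory"
    using \<psi>'_PiE lim' finite_models_right[OF N] mono
    by (auto simp: limit_objects_def intro!: exI[of _ "\<lambda>n. right_reduct (N n)"])
  \<comment> \<open>Any representing theon bounds the infimum; \<open>colour_theon\<close> supplies
    one of rank at most 1.\<close>
  have "limit_rank \<Omega> colour_theory \<psi>' \<le> enat 1"
    unfolding limit_rank_def using is_theon_colour[OF prob A] colour_theon_rank[OF prob A]
    by (intro Inf_lower) (auto simp: \<psi>'_def colour_theory_def)
  \<comment> \<open>The limit in closed form: each colour type has exactly one red-first expansion
    by an order, and that expansion carries all of its mass.\<close>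
  moreover define \<xi> where "\<xi> = (\<lambda>C\<in>iso_classes coloured_orders. let K = SOME K. K \<in> C in
    if red_first K then \<psi>' (iso_class colour_theory (right_reduct K)) else 0)"
  have \<xi>: "\<xi> (iso_class coloured_orders K) =
      (if red_first K then \<psi>' (iso_class colour_theory (right_reduct K)) else 0)"
    if K: "K \<in> finite_models coloured_orders" for K
  proof -
    define L where "L = (SOME L. L \<in> iso_class coloured_orders K)"
    have L: "L \<in> finite_models coloured_orders"
        "iso_class coloured_orders L = iso_class coloured_orders K"
      unfolding L_def by (intro some_in_iso_class iso_class_in_classes K)+
    then have i: "isomorphic K L"
      using iso_class_eqD K by metis
    then have "red_first L \<longleftrightarrow> red_first K"
      using red_first_isomorphic K L(1) isomorphic_sym by blast
    moreover have "iso_class colour_theory (right_reduct L) = iso_class colour_theory (right_reduct K)"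
      using i iso_class_eqI isomorphic_reduct(2) finite_models_right K L(1) by metis
    ultimately show ?thesis
      by (simp add: \<xi>_def iso_class_in_classes K flip: L_def)
  qed
  have "\<xi> \<in> couplings lin_order_theory colour_theory \<psi> \<psi>'"
  proof (rule couplingsI[where N = N])
    show "\<xi> \<in> iso_classes coloured_orders \<rightarrow>\<^sub>E {0..1}"
    proof (rule PiE_I)
      fix C assume "C \<in> iso_classes coloured_orders"
      then obtain K where K: "K \<in> finite_models coloured_orders" "C = iso_class coloured_orders K"
        by (rule iso_classesE)
      then show "\<xi> C \<in> {0..1}"
        using PiE_mem[OF \<psi>'_PiE iso_class_in_classes[OF finite_models_right[OF K(1)]]]
        by (simp add: \<xi>)
    qed (simp add: \<xi>_def)
    show "(\<lambda>n. density K (N n)) \<longlonglongrightarrow> \<xi> (iso_class coloured_orders K)"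
      if K: "K \<in> finite_models coloured_orders" for K
    proof -
      have "density K (N n) =
          (if red_first K then density (right_reduct K) (right_reduct (N n)) else 0)" for n
        by (intro density_red_first K N) (simp add: N_def red_first_coloured_order a)
      then show ?thesis
        using lim'[OF finite_models_right[OF K]] by (simp add: \<xi> K)
    qed
    show "(\<lambda>n. density M (left_reduct (N n))) \<longlonglongrightarrow> \<psi> (iso_class lin_order_theory M)"
      if "M \<in> finite_models lin_order_theory" for M
      using lin_order_density_limit[OF finite_models_left[OF N] _ that] mono \<psi> that
      by (simp add: limit_objects_lin_order iso_class_in_classes)
    show "finite (syms lin_order_theory)" "finite (syms colour_theory)"
      by (simp_all add: lin_order_theory_def colour_theory_def)
    show "\<psi> \<in> extensional (iso_classes lin_order_theory)"
      using \<psi> by (simp add: limit_objects_lin_order)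
    show "\<psi>' \<in> extensional (iso_classes colour_theory)"
      using \<psi>'_PiE by (simp add: PiE_def)
  qed (use N mono lim' in auto)
  moreover have "\<xi> \<noteq> indep_coupling lin_order_theory colour_theory \<psi> \<psi>'"
  proof -
    \<comment> \<open>Two points with the blue vertex 0 before the red vertex 1, a smallest
      structure that is not red-first. Here \<xi> is 0, while the independent coupling is positive
      because 0 < p < 1.\<close>
    let ?K = "coloured_order 2 {1}"
    have K: "?K \<in> finite_models coloured_orders"
      by (rule coloured_order_model) simp
    have "\<not> red_first ?K"
      by (auto simp: red_first_def nat_order_def simp del: rels_reduct intro!: exI[of _ 0])
    then have "\<xi> (iso_class coloured_orders ?K) = 0"
      using \<xi>[OF K] by simp
    moreover have "0 < \<psi>' (iso_class colour_theory (right_reduct ?K))"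
      using p finite_models_right[OF K]
      by (simp add: \<psi>'_def theon_limit_colour[OF prob A] flip: p_def)
    moreover have "0 < \<psi> (iso_class lin_order_theory (left_reduct ?K))"
      using \<psi> nat_order_model by (simp add: limit_objects_lin_order iso_class_in_classes)
    ultimately show ?thesis
      using indep_coupling_pos[OF K] by (metis less_irrefl)
  qed
  ultimately show ?thesis
    using \<psi>' canonical_colour_theory unfolding UCouple_def uniquely_coupleable_def by blast
qed

theorem theorem3p7:
  fixes \<Omega> :: "'x measure"
  assumes "prob_space \<Omega>" and "complete_measure \<Omega>" and "atomless \<Omega>"
  shows "(\<exists>!\<psi>. \<psi> \<in> limit_objects lin_order_theory) \<and>
    (\<forall>\<psi>\<in>limit_objects lin_order_theory.
       (\<forall>l. UInduce l lin_order_theory \<psi>) \<and> \<not> UCouple \<Omega> 1 lin_order_theory \<psi>)"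
  using UInduce_lin_order not_UCouple_lin_order[OF assms(1,3)]
  by (auto simp: limit_objects_lin_order)

end
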